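(* Let $\mathbb K\in\{\mathbb R,\mathbb C\}$, put $\eta_{\mathbb R}=1$, $\eta_{\mathbb C}=2$, let $p,q,d,k_\Sigma,k_\Omega,k$ be positive integers and $\varepsilon,\delta\in(0,1)$. Let $\Sigma\in\mathbb R^{k_\Sigma\times p}$ be drawn from the rescaled Gaussian distribution, let $\Omega\in\mathbb K^{k_\Omega\times q}$ be a $(\varepsilon/4,\delta/(3k_\Sigma),d)$ oblivious $\mathbb K^q\to\mathbb K^{k_\Omega}$ subspace embedding, and let $\Gamma\in\mathbb K^{k\times k_\Sigma k_\Omega}$ be a $(\varepsilon/4,\delta/3,d)$ oblivious $\mathbb K^{k_\Sigma k_\Omega}\to\mathbb K^k$ subspace embedding. Assume that $\Sigma,\Omega,\Gamma$ are independent. If $$k_\Sigma\ \ge\ 168\,\varepsilon^{-2}\big(6.9\,\eta_{\mathbb K}\,d+\log(6/\delta)\big),$$ then $\Upsilon:\mathbb K^{q\times p}\to\mathbb K^k$, $\Upsilon(X):=\Gamma\,\mathrm{vec}(\Omega X\Sigma^* )$, is a $(\varepsilon,\delta,d)$ oblivious $\mathbb K^{q\times p}\to\mathbb K^k$ subspace embedding.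
   Context: A $k\times n$ rescaled Gaussian matrix has i.i.d. real Gaussian entries with mean $0$ and variance $1/k$. $M^*$ is the conjugate transpose and $\mathrm{vec}$ stacks the columns of a matrix into a vector. $\mathbb K^n$ carries its canonical inner product and $\mathbb K^{q\times p}$ the Frobenius inner product $\langle X,Y\rangle_F=\mathrm{Tr}(X^*Y)$. For a finite-dimensional inner product space $Z$ over $\mathbb K$, a random linear map $\Theta:Z\to\mathbb K^k$ (a random matrix being identified with the linear map it defines) is called a $(\varepsilon,\delta,d)$ oblivious $Z\to\mathbb K^k$ subspace embedding if for every (deterministic) subspace $Z_d\subset Z$ with $\dim Z_d=d$, $$\mathbb P\big(\forall x,y\in Z_d:\ |\langle x,y\rangle_Z-\langle\Theta(x),\Theta(y)\rangle_2|\le\varepsilon\|x\|_Z\|y\|_Z\big)\ge 1-\delta .$$ This notion is only considered for $1\le d\le\dim Z$, for every embedding appearing in the statement. *)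

theory Defs
  imports "HOL-Probability.Probability" "Jordan_Normal_Form.Conjugate"
begin

text \<open>
  The scalar field is a type \<open>'a\<close>, instantiated with \<^typ>\<open>real\<close> and \<^typ>\<open>complex\<close>;
  \<^const>\<open>conjugate\<close> is the identity on the former and \<^const>\<open>cnj\<close> on the latter.
  A matrix with rows indexed by \<open>'m\<close> and columns indexed by \<open>'n\<close> has type \<open>'a^'n^'m\<close>.
\<close>

definition adjoint_matrix :: "('a::conjugate)^'n^'m \<Rightarrow> 'a^'m^'n" where
  "adjoint_matrix A = map_matrix conjugate (transpose A)"

definition scale_matrix :: "'a::times \<Rightarrow> 'a^'n^'m \<Rightarrow> 'a^'n^'m" where
  "scale_matrix c A = map_matrix ((*) c) A"

text \<open>
  Stacking of columns. The entry of the stacked vector at position \<open>(j, i)\<close> is the \<open>i\<close>-th entry of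
  the \<open>j\<close>-th column, so the lexicographic order on the index type \<open>'n \<times> 'm\<close> is the column-major
  order. (The constant \<^const>\<open>vec\<close> of the library is the unrelated constant vector.)
\<close>

definition vectorize :: "'a^'n^'m \<Rightarrow> 'a^('n \<times> 'm)" where
  "vectorize A = (\<chi> ji. A $ snd ji $ fst ji)"

definition canonical_inner :: "('a::conjugatable_field)^'n \<Rightarrow> 'a^'n \<Rightarrow> 'a" where
  "canonical_inner x y = (\<Sum>i\<in>UNIV. conjugate (x $ i) * y $ i)"

definition frobenius_inner :: "('a::conjugatable_field)^'n^'m \<Rightarrow> 'a^'n^'m \<Rightarrow> 'a" where
  "frobenius_inner X Y = trace (adjoint_matrix X ** Y)"

definition induced_norm :: "('z \<Rightarrow> 'z \<Rightarrow> 'a::real_normed_field) \<Rightarrow> 'z \<Rightarrow> real" where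
  "induced_norm ip x = sqrt (norm (ip x x))"

text \<open>
  In the following two definitions the domain \<open>Z\<close> is the whole type \<open>'z\<close>, with scalar
  multiplication \<open>smul\<close> and inner product \<open>ip\<close>.
  As \<open>Z\<close> has finite dimension, measurability of a random linear map amounts to measurability of
  its value at every fixed point.
\<close>

definition random_linear_map ::
  "'w measure \<Rightarrow> ('a::real_normed_field \<Rightarrow> 'z::ab_group_add \<Rightarrow> 'z) \<Rightarrow> ('w \<Rightarrow> 'z \<Rightarrow> 'a^'k) \<Rightarrow> bool"
where
  "random_linear_map M smul \<Theta> \<longleftrightarrow>
     (\<forall>\<omega>\<in>space M. Vector_Spaces.linear smul (*s) (\<Theta> \<omega>)) \<and>
     (\<forall>x. (\<lambda>\<omega>. \<Theta> \<omega> x) \<in> borel_measurable M)"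

definition oblivious_subspace_embedding ::
  "'w measure \<Rightarrow> ('a::{conjugatable_field, real_normed_field} \<Rightarrow> 'z::ab_group_add \<Rightarrow> 'z) \<Rightarrow>
   ('z \<Rightarrow> 'z \<Rightarrow> 'a) \<Rightarrow> real \<Rightarrow> real \<Rightarrow> nat \<Rightarrow> ('w \<Rightarrow> 'z \<Rightarrow> 'a^'k) \<Rightarrow> bool"
where
  "oblivious_subspace_embedding M smul ip \<epsilon> \<delta> d \<Theta> \<longleftrightarrow>
     1 \<le> d \<and> d \<le> vector_space.dim smul (UNIV :: 'z set) \<and>
     random_linear_map M smul \<Theta> \<and>
     (\<forall>V. module.subspace smul V \<and> vector_space.dim smul V = d \<longrightarrow>
        measure M {\<omega> \<in> space M. \<forall>x\<in>V. \<forall>y\<in>V.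
            norm (ip x y - canonical_inner (\<Theta> \<omega> x) (\<Theta> \<omega> y))
              \<le> \<epsilon> * induced_norm ip x * induced_norm ip y}
          \<ge> 1 - \<delta>)"

text \<open>A random matrix with \<open>k\<close> rows is rescaled Gaussian if its entries are i.i.d. \<open>N(0, 1/k)\<close>.\<close>

definition rescaled_gaussian :: "'w measure \<Rightarrow> ('w \<Rightarrow> real^'n^'k) \<Rightarrow> bool" where
  "rescaled_gaussian M S \<longleftrightarrow>
     prob_space.indep_vars M (\<lambda>_. borel) (\<lambda>(i, j) \<omega>. S \<omega> $ i $ j) UNIV \<and>
     (\<forall>i j. distributed M lborel (\<lambda>\<omega>. S \<omega> $ i $ j)
        (\<lambda>x. ennreal (normal_density 0 (sqrt (1 / real CARD('k))) x)))"

text \<open>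
  \<^const>\<open>prob_space.indep_vars\<close> requires all random variables to have the same codomain type,
  so independence of three random variables with different codomains is expressed through the
  \<open>\<sigma>\<close>-algebras they generate.
\<close>

definition indep_var3 ::
  "'w measure \<Rightarrow> ('w \<Rightarrow> 'b::topological_space) \<Rightarrow> ('w \<Rightarrow> 'c::topological_space) \<Rightarrow>
   ('w \<Rightarrow> 'e::topological_space) \<Rightarrow> bool"
where
  "indep_var3 M X Y Z \<longleftrightarrow>
     X \<in> borel_measurable M \<and> Y \<in> borel_measurable M \<and> Z \<in> borel_measurable M \<and>
     prob_space.indep_sets M
       (\<lambda>i. [sets (vimage_algebra (space M) X borel),
             sets (vimage_algebra (space M) Y borel),
             sets (vimage_algebra (space M) Z borel)] ! i) {..<3}"

text \<open>The real matrix \<open>\<Sigma>\<close> is regarded as a matrix over \<open>'a\<close> via \<^const>\<open>of_real\<close>.\<close>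

definition Upsilon ::
  "real^'p^'ks \<Rightarrow> 'a^'q^'ko \<Rightarrow> 'a^('ks \<times> 'ko)^'k \<Rightarrow>
   'a::{conjugatable_field, real_normed_field}^'p^'q \<Rightarrow> 'a^'k"
where
  "Upsilon \<Sigma> \<Omega> \<Gamma> X =
     \<Gamma> *v vectorize (\<Omega> ** X ** adjoint_matrix (map_matrix of_real \<Sigma>))"

end

theory Submission
  imports Defs
begin

text \<open>
  Write \<open>T\<^sub>1(X) = X\<Sigma>\<^sup>*\<close>, \<open>T\<^sub>2(Y) = \<Omega> Y\<close> and \<open>T\<^sub>3(W) = \<Gamma> vec(W)\<close>, so that
  \<open>\<Upsilon> = T\<^sub>3 \<circ> T\<^sub>2 \<circ> T\<^sub>1\<close>. Each stage distorts squared norms by a factor in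
  \<open>[1 - \<epsilon>/4, 1 + \<epsilon>/4]\<close> except with probability \<open>\<delta>/3\<close>; as \<open>\<epsilon> < 1\<close>,
  three such stages distort by at most \<open>\<epsilon>\<close> in total (\<open>three_step_distortion\<close>).
  By polarization, and by rotating one argument with a scalar of modulus one, the inner product
  estimate in the definition of an embedding is equivalent to the estimate for squared norms
  (\<open>embedding_iff_near_isometry\<close>), so only the latter is ever propagated.

  The second and third stage act on subspaces that are random. The columns of \<open>X\<Sigma>\<^sup>*\<close>, for
  \<open>X \<in> V\<close>, are images of \<open>V\<close> under maps that depend on \<open>\<Sigma>\<close> only; the vectors
  \<open>vec(\<Omega> X\<Sigma>\<^sup>*)\<close> are images under a map that depends on \<open>(\<Sigma>, \<Omega>)\<close> only.
  For each fixed value of those matrices the image has dimension at most \<open>d\<close> and lies in a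
  subspace of dimension exactly \<open>d\<close>, to which the hypothesis on \<open>\<Omega>\<close> or \<open>\<Gamma>\<close> applies;
  independence and Fubini turn this into a bound on the unconditional probability
  (\<open>prob_near_isometry_on_random_image\<close>). For \<open>\<Omega>\<close> this is done for each of the \<open>k\<^sub>\<Sigma>\<close> columns,
  and the squared Frobenius norm is the sum of the squared norms of the columns.

  The first stage is the quantitative one (\<open>gaussian_near_isometry\<close>). The subspace \<open>V\<close>, regarded as a real
  space of dimension at most \<open>\<eta> d\<close>, has a net of radius \<open>1/16\<close> in its unit ball with at most
  \<open>88\<^bsup>\<eta> d\<^esup>\<close> points (\<open>unit_ball_net\<close>), and distortion at most \<open>t\<close> on the net gives distortion at most
  \<open>8t/7\<close> on \<open>V\<close> (\<open>near_isometry_on_from_net\<close>). For a fixed \<open>X\<close> of norm one, \<open>k\<^sub>\<Sigma> \<parallel>X\<Sigma>\<^sup>*\<parallel>\<^sup>2\<close> is a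
  sum of \<open>k\<^sub>\<Sigma>\<close> independent variables, each a convex combination of squares of standard
  Gaussians. Convexity of the exponential bounds its moment generating function by that of one
  such square, without any diagonalization (\<open>nn_integral_exp_norm_gaussian_le\<close>), and Chernoff's bound gives
  the tail \<open>2 exp(-k\<^sub>\<Sigma> t\<^sup>2/8)\<close> (\<open>gaussian_matrix_concentration\<close>). The union bound over the net with
  \<open>t = 7/32 \<epsilon>\<close> is what the lower bound on \<open>k\<^sub>\<Sigma>\<close> pays for: \<open>168 \<cdot> 49/8192 > 1\<close>
  and \<open>88 < e\<^bsup>6.9\<^esup>\<close>.
\<close>

section \<open>The real and complex scalars\<close>

text \<open>
  The properties shared by the two scalar fields that the proof uses. The real inner product is
  the real part of the Hermitian one, and the real dimension of the field is the factor \<open>\<eta>\<close>.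
\<close>

class scalar_field = conjugatable_field + real_normed_field + euclidean_space +
  assumes inner_conjugate: "inner x y = inner 1 (conjugate x * y)"
    and conjugate_mult_self_scaleR: "conjugate x * x = (norm x)\<^sup>2 *\<^sub>R 1"

lemma conjugate_mult_self: "conjugate x * x = of_real ((norm (x::'a::scalar_field))\<^sup>2)"
  by (simp add: conjugate_mult_self_scaleR of_real_def)

instance real :: scalar_field
  by intro_classes (auto simp: power2_eq_square)

instance complex :: scalar_field
  by intro_classes (auto simp: inner_complex_def mult.commute complex_mult_cnj cmod_power2 scaleR_conv_of_real)

lemma conjugate_of_real [simp]: "conjugate (of_real r :: 'a::scalar_field) = of_real r"
proof (cases "r = 0")
  case False
  then show ?thesis
    using conjugate_mult_self[of "of_real r :: 'a"] by (simp add: power2_eq_square)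
qed simp

lemma inner_one_of_real [simp]: "inner 1 (of_real r :: 'a::scalar_field) = r"
  by (metis inner_conjugate mult_1 inner_real_def inner_scaleR_right norm_one of_real_def
      power2_norm_eq_inner mult.right_neutral power_one)

text \<open>
  A space over the scalars whose Hermitian form refines a given real inner product. This covers
  both vectors and matrices, and makes real notions such as orthonormal bases, nets and Borel sets
  available for them.
\<close>
locale compatible_inner_product = vector_space smul
  for smul :: "'a::scalar_field \<Rightarrow> 'z::euclidean_space \<Rightarrow> 'z" +
  fixes ip :: "'z \<Rightarrow> 'z \<Rightarrow> 'a"
  assumes smul_of_real: "smul (of_real r) x = r *\<^sub>R x"
    and norm_smul: "norm (smul c x) = norm c * norm x"
    and ip_smul_right: "ip x (smul c y) = c * ip x y"
    and inner_ip: "inner x y = inner 1 (ip x y)"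
    and ip_self: "ip x x = of_real ((norm x)\<^sup>2)"
begin

lemma induced_norm_ip [simp]: "induced_norm ip x = norm x"
  by (simp add: induced_norm_def ip_self del: of_real_power)

lemma real_subspace: "subspace V \<Longrightarrow> real_vector.subspace V"
  unfolding subspace_def real_vector.subspace_def smul_of_real[symmetric] by blast

text \<open>
  If \<open>B\<close> is a basis over the scalars, the products of \<open>B\<close> with a real basis of the scalars span
  over the reals.
\<close>
lemma real_dim_le:
  assumes "dim V = d" "1 \<le> d"
  shows "real_vector.dim V \<le> DIM('a) * d"
proof -
  obtain B where B: "B \<subseteq> V" "independent B" "V \<subseteq> span B" "card B = d"
    using basis_exists[of V] assms by blast
  then have fin: "finite B" using assms card.infinite by fastforce
  define C where "C = (\<lambda>(e, b). smul e b) ` (Basis \<times> B)"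
  have "smul c b \<in> real_vector.span C" if "b \<in> B" for c b
  proof -
    have "smul c b = smul (\<Sum>e\<in>Basis. (c \<bullet> e) *\<^sub>R e) b" by (simp add: euclidean_representation)
    also have "\<dots> = (\<Sum>e\<in>Basis. smul ((c \<bullet> e) *\<^sub>R e) b)" by (rule scale_sum_left)
    also have "\<dots> = (\<Sum>e\<in>Basis. (c \<bullet> e) *\<^sub>R smul e b)"
      by (simp add: scaleR_conv_of_real smul_of_real flip: scale_scale)
    also have "\<dots> \<in> real_vector.span C"
      using that by (intro real_vector.span_sum real_vector.span_scale real_vector.span_base) (auto simp: C_def)
    finally show ?thesis .
  qed
  then have "span B \<subseteq> real_vector.span C"
    by (auto simp: span_explicit intro!: real_vector.span_sum)
  then have "V \<subseteq> real_vector.span C" using B by blast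
  then have "real_vector.dim V \<le> card C"
    using fin by (intro real_vector.dim_le_card) (auto simp: C_def)
  also have "\<dots> \<le> card ((Basis :: 'a set) \<times> B)" unfolding C_def by (rule card_image_le) (use fin in auto)
  finally show ?thesis using B by (simp add: card_cartesian_product)
qed

end

section \<open>Near isometries\<close>

text \<open>
  Squared norms are used rather than norms, so that the estimates for the columns of a matrix add up.
\<close>
definition near_isometry_on :: "'z::real_normed_vector set \<Rightarrow> ('z \<Rightarrow> 'y::real_normed_vector) \<Rightarrow> real \<Rightarrow> bool" where
  "near_isometry_on V T \<epsilon> \<longleftrightarrow> (\<forall>x\<in>V. \<bar>(norm (T x))\<^sup>2 - (norm x)\<^sup>2\<bar> \<le> \<epsilon> * (norm x)\<^sup>2)"

lemma inner_polarization:
  fixes x y :: "'z::real_inner"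
  shows "inner x y = ((norm (x + y))\<^sup>2 - (norm (x - y))\<^sup>2) / 4"
  by (simp add: power2_norm_eq_inner inner_add inner_diff inner_commute)

text \<open>
  Polarize, and bound the two resulting quadratic terms with the parallelogram law; this loses
  nothing only when both arguments have equal norm, hence the normalization.
\<close>
lemma near_isometry_inner:
  fixes T :: "'z::real_inner \<Rightarrow> 'y::real_inner"
  assumes T: "near_isometry_on V T \<epsilon>" "linear T" and V: "subspace V" "x \<in> V" "y \<in> V"
  shows "\<bar>inner (T x) (T y) - inner x y\<bar> \<le> \<epsilon> * norm x * norm y"
proof (cases "x = 0 \<or> y = 0")
  case True then show ?thesis using linear_0[OF T(2)] by auto
next
  case False
  define q where "q z = (norm (T z))\<^sup>2 - (norm z)\<^sup>2" for z
  have q: "\<bar>q z\<bar> \<le> \<epsilon> * (norm z)\<^sup>2" if "z \<in> V" for z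
    using T(1) that by (auto simp: near_isometry_on_def q_def)
  define u where "u = x /\<^sub>R norm x"
  define v where "v = y /\<^sub>R norm y"
  have uv: "u \<in> V" "v \<in> V" "norm u = 1" "norm v = 1"
    using V False by (auto simp: u_def v_def subspace_scale)
  have "inner (T u) (T v) - inner u v = (q (u + v) - q (u - v)) / 4"
    by (simp add: inner_polarization[of u v] inner_polarization[of "T u" "T v"] q_def
        linear_add[OF T(2)] linear_diff[OF T(2)] field_simps)
  also have "\<bar>\<dots>\<bar> \<le> (\<epsilon> * (norm (u + v))\<^sup>2 + \<epsilon> * (norm (u - v))\<^sup>2) / 4"
    using q[of "u + v"] q[of "u - v"] V uv by (simp add: subspace_add subspace_diff)
  also have "\<dots> = \<epsilon>"
    using uv by (simp add: power2_norm_eq_inner inner_add inner_diff inner_commute norm_eq_1 algebra_simps)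
  finally have *: "\<bar>inner (T u) (T v) - inner u v\<bar> \<le> \<epsilon>" .
  have "inner (T x) (T y) - inner x y = (norm x * norm y) * (inner (T u) (T v) - inner u v)"
    using False by (simp add: u_def v_def linear_scale[OF T(2)] field_simps)
  then have "\<bar>inner (T x) (T y) - inner x y\<bar> = (norm x * norm y) * \<bar>inner (T u) (T v) - inner u v\<bar>"
    by (simp add: abs_mult)
  also have "\<dots> \<le> (norm x * norm y) * \<epsilon>" by (intro mult_left_mono *) auto
  finally show ?thesis by (simp add: mult_ac)
qed

section \<open>Vectors and matrices as inner product spaces\<close>

lemma canonical_inner_product:
  "compatible_inner_product (*s) (canonical_inner :: 'a::scalar_field^'n \<Rightarrow> _)"
proof
  fix x y :: "'a^'n" and r :: real and c :: 'a
  show "of_real r *s x = r *\<^sub>R x" by (simp add: vec_eq_iff scaleR_conv_of_real[where 'a='a])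
  show "norm (c *s x) = norm c * norm x"
    by (simp add: norm_vec_def L2_set_def norm_mult power_mult_distrib real_sqrt_mult flip: sum_distrib_left)
  show "canonical_inner x (c *s y) = c * canonical_inner x y"
    by (simp add: canonical_inner_def sum_distrib_left mult_ac)
  show "inner x y = inner 1 (canonical_inner x y)"
    by (simp add: canonical_inner_def inner_vec_def inner_sum_right flip: inner_conjugate)
  show "canonical_inner x x = of_real ((norm x)\<^sup>2)"
    by (simp add: canonical_inner_def conjugate_mult_self norm_vec_def L2_set_def sum_nonneg)
qed

lemma sum_UNIV_prod:
  fixes f :: "'j::finite \<times> 'i::finite \<Rightarrow> 'b::comm_monoid_add"
  shows "(\<Sum>p\<in>UNIV. f p) = (\<Sum>i\<in>UNIV. \<Sum>j\<in>UNIV. f (j, i))"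
proof -
  have "(\<Sum>p\<in>UNIV. f p) = (\<Sum>j\<in>UNIV. \<Sum>i\<in>UNIV. f (j, i))"
    by (simp add: sum.cartesian_product flip: UNIV_Times_UNIV)
  also have "\<dots> = (\<Sum>i\<in>UNIV. \<Sum>j\<in>UNIV. f (j, i))" by (rule sum.swap)
  finally show ?thesis .
qed

text \<open>
  Stacking of columns is an isometry of the Frobenius inner product, so the facts for matrices
  reduce to those for vectors.
\<close>
lemma norm_vectorize: "norm (vectorize A :: 'a::real_normed_vector^('n::finite \<times> 'm::finite)) = norm A"
  by (simp add: norm_vec_def L2_set_def vectorize_def sum_nonneg sum_UNIV_prod)

lemma vectorize_linear:
  "vectorize (A + B) = vectorize A + vectorize B"
  "vectorize (scale_matrix c A) = c *s vectorize A"
  by (simp_all add: vectorize_def scale_matrix_def map_matrix_def vec_eq_iff)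

lemma frobenius_inner_vectorize:
  "frobenius_inner X Y = canonical_inner (vectorize X) (vectorize Y)"
proof -
  have "frobenius_inner X Y = (\<Sum>j\<in>UNIV. \<Sum>i\<in>UNIV. conjugate (X $ i $ j) * Y $ i $ j)"
    by (simp add: frobenius_inner_def trace_def adjoint_matrix_def matrix_matrix_mult_def
        map_matrix_def transpose_def)
  also have "\<dots> = (\<Sum>i\<in>UNIV. \<Sum>j\<in>UNIV. conjugate (X $ i $ j) * Y $ i $ j)" by (rule sum.swap)
  finally show ?thesis by (simp add: canonical_inner_def vectorize_def sum_UNIV_prod)
qed

lemma inner_vectorize:
  "inner (vectorize A) (vectorize B) = inner A (B :: 'a::real_inner^'n::finite^'m::finite)"
  by (simp add: inner_vec_def vectorize_def sum_UNIV_prod)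

lemma frobenius_inner_product:
  "compatible_inner_product scale_matrix (frobenius_inner :: 'a::scalar_field^'p^'q \<Rightarrow> _)"
proof -
  interpret C: compatible_inner_product "(*s)" "canonical_inner :: 'a^('p \<times> 'q) \<Rightarrow> _"
    by (rule canonical_inner_product)
  show ?thesis
  proof unfold_locales
    fix x y :: "'a^'p^'q" and r :: real and c :: 'a
    show "scale_matrix (of_real r) x = r *\<^sub>R x"
      by (simp add: scale_matrix_def map_matrix_def vec_eq_iff scaleR_conv_of_real[where 'a='a])
    show "norm (scale_matrix c x) = norm c * norm x"
      by (metis norm_vectorize vectorize_linear(2) C.norm_smul)
    show "frobenius_inner x (scale_matrix c y) = c * frobenius_inner x y"
      by (simp add: frobenius_inner_vectorize vectorize_linear C.ip_smul_right)
    show "inner x y = inner 1 (frobenius_inner x y)"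
      by (simp add: frobenius_inner_vectorize inner_vectorize flip: C.inner_ip)
    show "frobenius_inner x x = of_real ((norm x)\<^sup>2)"
      by (simp add: frobenius_inner_vectorize C.ip_self norm_vectorize)
  qed (simp_all add: algebra_simps vec_eq_iff scale_matrix_def map_matrix_def)
qed

lemma (in compatible_inner_product) linear_real_linear:
  assumes "Vector_Spaces.linear smul (*s) (T :: 'z \<Rightarrow> 'a^'k)"
  shows "linear T"
proof
  interpret T: Vector_Spaces.linear smul "(*s)" T by fact
  interpret C: compatible_inner_product "(*s)" "canonical_inner :: 'a^'k \<Rightarrow> _"
    by (rule canonical_inner_product)
  show "T (x + y) = T x + T y" for x y by (rule T.add)
  show "T (r *\<^sub>R x) = r *\<^sub>R T x" for r x using T.scale[of "of_real r" x]
    by (simp add: smul_of_real C.smul_of_real)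
qed

text \<open>
  The bilinear estimate follows from the quadratic one because the defect \<open>a\<close> of a given pair can be
  made real and nonnegative by multiplying the second vector with a scalar of modulus one, which
  changes neither norm nor membership in the subspace.
\<close>
lemma (in compatible_inner_product) embedding_iff_near_isometry:
  assumes T: "Vector_Spaces.linear smul (*s) (T :: 'z \<Rightarrow> 'a^'k)" and V: "subspace V"
  shows "(\<forall>x\<in>V. \<forall>y\<in>V. norm (ip x y - canonical_inner (T x) (T y))
             \<le> \<epsilon> * induced_norm ip x * induced_norm ip y) \<longleftrightarrow> near_isometry_on V T \<epsilon>"
proof -
  interpret T: Vector_Spaces.linear smul "(*s)" T by fact
  interpret C: compatible_inner_product "(*s)" "canonical_inner :: 'a^'k \<Rightarrow> _"
    by (rule canonical_inner_product)
  show ?thesis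
  proof
    assume L: "\<forall>x\<in>V. \<forall>y\<in>V. norm (ip x y - canonical_inner (T x) (T y))
             \<le> \<epsilon> * induced_norm ip x * induced_norm ip y"
    show "near_isometry_on V T \<epsilon>"
      unfolding near_isometry_on_def
    proof
      fix x assume "x \<in> V"
      then have "norm (ip x x - canonical_inner (T x) (T x)) \<le> \<epsilon> * norm x * norm x" using L by simp
      also have "ip x x - canonical_inner (T x) (T x) = of_real ((norm x)\<^sup>2 - (norm (T x))\<^sup>2)"
        by (simp only: ip_self C.ip_self of_real_diff)
      finally show "\<bar>(norm (T x))\<^sup>2 - (norm x)\<^sup>2\<bar> \<le> \<epsilon> * (norm x)\<^sup>2"
        unfolding norm_of_real by (simp add: power2_eq_square abs_minus_commute)
    qed
  next
    assume near: "near_isometry_on V T \<epsilon>"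
    show "\<forall>x\<in>V. \<forall>y\<in>V. norm (ip x y - canonical_inner (T x) (T y))
             \<le> \<epsilon> * induced_norm ip x * induced_norm ip y"
    proof (intro ballI)
      fix x y assume xy: "x \<in> V" "y \<in> V"
      define a where "a = ip x y - canonical_inner (T x) (T y)"
      define u where "u = (if a = 0 then 1 else of_real (norm a) / a)"
      have u: "norm u = 1" "u * a = of_real (norm a)" by (auto simp: u_def norm_divide)
      have "norm a = inner 1 (u * a)" by (simp add: u)
      also have "\<dots> = inner x (smul u y) - inner (T x) (T (smul u y))"
        by (simp add: a_def inner_ip C.inner_ip ip_smul_right C.ip_smul_right T.scale
            right_diff_distrib inner_diff_right)
      also have "\<dots> \<le> \<epsilon> * norm x * norm (smul u y)"
        using near_isometry_inner[OF near linear_real_linear[OF T] real_subspace[OF V] xy(1),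
           of "smul u y"] V xy by (auto simp: subspace_scale)
      finally show "norm (ip x y - canonical_inner (T x) (T y))
             \<le> \<epsilon> * induced_norm ip x * induced_norm ip y"
        using u by (simp add: norm_smul a_def)
    qed
  qed
qed

section \<open>Dimensions of subspaces\<close>

text \<open>
  The image of a \<open>d\<close>-dimensional space may have smaller dimension, while the embeddings are only
  assumed to work on subspaces of dimension exactly \<open>d\<close>.
\<close>
lemma vec_subspace_extend:
  fixes U :: "('a::field^'n) set"
  assumes "vec.dim U \<le> d" "d \<le> CARD('n)"
  obtains W where "vec.subspace W" "vec.dim W = d" "U \<subseteq> W"
proof -
  obtain B where B: "B \<subseteq> U" "vec.independent B" "U \<subseteq> vec.span B" "card B = vec.dim U"
    by (rule vec.basis_exists[of U])
  obtain C where C: "B \<subseteq> C" "vec.independent C" "vec.span C = UNIV"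
    using vec.maximal_independent_subset_extend[of B UNIV] B by (metis subset_UNIV top.extremum_uniqueI)
  have "card C = CARD('n)"
    using C by (metis vec.dim_eq_card_independent vec.dim_span vec_dim_card)
  moreover have "finite C" using C vec.independent_bound_general by blast
  ultimately obtain A where A: "B \<subseteq> A" "A \<subseteq> C" "card A = d"
    using exists_subset_between[of B d C] assms B C by auto
  have "vec.independent A" using A C vec.independent_mono by blast
  then have "vec.dim (vec.span A) = d" using A by (simp add: vec.dim_eq_card_independent)
  moreover have "U \<subseteq> vec.span A" using B A vec.span_mono by blast
  ultimately show thesis using that[of "vec.span A"] by blast
qed

lemma dim_scale_matrix_UNIV:
  "vector_space.dim scale_matrix (UNIV :: ('a::scalar_field^'p^'q) set) = CARD('p) * CARD('q)"
proof -
  interpret F: compatible_inner_product scale_matrix "frobenius_inner :: 'a^'p^'q \<Rightarrow> _"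
    by (rule frobenius_inner_product)
  define g :: "'a^('p \<times> 'q) \<Rightarrow> 'a^'p^'q" where "g v = (\<chi> i j. v $ (j, i))" for v
  interpret g: Vector_Spaces.linear "(*s)" scale_matrix g
    by unfold_locales (auto simp: g_def scale_matrix_def map_matrix_def vec_eq_iff algebra_simps)
  have inj: "inj g" by (auto simp: inj_def g_def vec_eq_iff)
  have "surj g"
  proof (rule surjI)
    show "g (vectorize A) = A" for A by (simp add: g_def vectorize_def vec_eq_iff)
  qed
  have "F.independent (g ` cart_basis)"
    using g.independent_injective_image[of cart_basis] inj
    by (simp add: independent_cart_basis inj_on_subset)
  moreover have "F.span (g ` cart_basis) = UNIV"
    using g.span_image[of cart_basis] \<open>surj g\<close> by simp
  ultimately have "F.dim UNIV = card (g ` cart_basis)"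
    by (intro F.dim_eq_card) auto
  also have "\<dots> = CARD('p) * CARD('q)"
    using inj by (simp add: card_image inj_on_subset card_cart_basis)
  finally show ?thesis .
qed

lemma vec_dim_linear_image_le:
  assumes "Vector_Spaces.linear smul ((*s) :: _ \<Rightarrow> 'a::field^'n \<Rightarrow> _) f"
    and "vector_space.dim smul V = d" "1 \<le> d"
  shows "vec.dim (f ` V) \<le> d"
proof -
  interpret f: Vector_Spaces.linear smul "(*s)" f by fact
  obtain B where B: "B \<subseteq> V" "f.vs1.independent B" "V \<subseteq> f.vs1.span B" "card B = d"
    using f.vs1.basis_exists[of V] assms by blast
  then have fin: "finite B" using assms card.infinite by fastforce
  have "f ` V \<subseteq> vec.span (f ` B)" using B f.span_image[of B] by blast
  then have "vec.dim (f ` V) \<le> card (f ` B)" using fin by (intro vec.dim_le_card) auto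
  also have "\<dots> \<le> d" using B fin card_image_le by blast
  finally show ?thesis .
qed

section \<open>Nets of the unit ball of a subspace\<close>

text \<open>
  Each point of the l1 ball of radius \<open>L\<close> has weight at least \<open>r\<^sup>L\<close> when a point \<open>z\<close> is given the
  weight \<open>r\<^bsup>\<parallel>z\<parallel>\<^sub>1\<^esup>\<close>; the total weight is a product of two-sided geometric sums.
\<close>
lemma card_integer_points_l1_ball:
  fixes L :: nat and r :: real
  assumes "finite B" "0 < r" "r < 1"
  shows "finite {z \<in> B \<rightarrow>\<^sub>E {- int L..int L}. (\<Sum>b\<in>B. \<bar>z b\<bar>) \<le> int L}"
    and "real (card {z \<in> B \<rightarrow>\<^sub>E {- int L..int L}. (\<Sum>b\<in>B. \<bar>z b\<bar>) \<le> int L}) * r ^ L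
          \<le> ((1 + r) / (1 - r)) ^ card B"
proof -
  define Z where "Z = {z \<in> B \<rightarrow>\<^sub>E {- int L..int L}. (\<Sum>b\<in>B. \<bar>z b\<bar>) \<le> int L}"
  have finE: "finite (B \<rightarrow>\<^sub>E {- int L..int L})" using assms by (intro finite_PiE) auto
  then have finZ: "finite Z" by (auto simp: Z_def)
  have geom: "(\<Sum>n\<in>{- int L..int L}. r ^ nat \<bar>n\<bar>) \<le> (1 + r) / (1 - r)"
  proof -
    have "(\<Sum>n\<in>{0..int L}. r ^ nat \<bar>n\<bar>) = (\<Sum>n<Suc L. r ^ n)"
      by (rule sum.reindex_bij_witness[of _ int nat]) auto
    moreover have "(\<Sum>n\<in>{- int L..-1}. r ^ nat \<bar>n\<bar>) = (\<Sum>n<L. r ^ Suc n)"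
      by (rule sum.reindex_bij_witness[of _ "\<lambda>n. - int (Suc n)" "\<lambda>n. nat (- n - 1)"])
        (auto simp: Suc_nat_eq_nat_zadd1 simp flip: power_Suc)
    moreover have "(\<Sum>n\<in>{- int L..int L}. r ^ nat \<bar>n\<bar>)
        = (\<Sum>n\<in>{- int L..-1}. r ^ nat \<bar>n\<bar>) + (\<Sum>n\<in>{0..int L}. r ^ nat \<bar>n\<bar>)"
      by (subst sum.union_disjoint[symmetric]) (auto intro!: sum.cong)
    moreover have "(\<Sum>n<L. r ^ Suc n) = r * (\<Sum>n<L. r ^ n)" by (simp add: sum_distrib_left)
    moreover have "(\<Sum>n<m. r ^ n) \<le> 1 / (1 - r)" for m
      using assms by (simp add: sum_gp_strict divide_right_mono)
    ultimately have "(\<Sum>n\<in>{- int L..int L}. r ^ nat \<bar>n\<bar>) \<le> r * (1 / (1 - r)) + 1 / (1 - r)"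
      using assms by (metis add_mono mult_left_mono less_imp_le)
    then show ?thesis using assms by (simp add: add_divide_distrib)
  qed
  have "real (card Z) * r ^ L = (\<Sum>z\<in>Z. r ^ L)" by simp
  also have "\<dots> \<le> (\<Sum>z\<in>Z. \<Prod>b\<in>B. r ^ nat \<bar>z b\<bar>)"
  proof (rule sum_mono)
    fix z assume "z \<in> Z"
    then have "(\<Sum>b\<in>B. \<bar>z b\<bar>) \<le> int L" by (simp add: Z_def)
    moreover have "(\<Sum>b\<in>B. \<bar>z b\<bar>) = int (\<Sum>b\<in>B. nat \<bar>z b\<bar>)" by simp
    ultimately have "(\<Sum>b\<in>B. nat \<bar>z b\<bar>) \<le> L" by linarith
    then have "r ^ L \<le> r ^ (\<Sum>b\<in>B. nat \<bar>z b\<bar>)" using assms by (intro power_decreasing) auto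
    then show "r ^ L \<le> (\<Prod>b\<in>B. r ^ nat \<bar>z b\<bar>)" by (simp add: power_sum)
  qed
  also have "\<dots> \<le> (\<Sum>z\<in>B \<rightarrow>\<^sub>E {- int L..int L}. \<Prod>b\<in>B. r ^ nat \<bar>z b\<bar>)"
    using finE assms by (intro sum_mono2) (auto simp: Z_def intro!: prod_nonneg)
  also have "\<dots> = (\<Prod>b\<in>B. \<Sum>n\<in>{- int L..int L}. r ^ nat \<bar>n\<bar>)"
    using assms by (subst prod_sum_PiE) auto
  also have "\<dots> \<le> ((1 + r) / (1 - r)) ^ card B"
    using geom assms by (simp add: power_mono sum_nonneg)
  finally show "real (card {z \<in> B \<rightarrow>\<^sub>E {- int L..int L}. (\<Sum>b\<in>B. \<bar>z b\<bar>) \<le> int L}) * r ^ L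
          \<le> ((1 + r) / (1 - r)) ^ card B" by (simp add: Z_def)
  show "finite {z \<in> B \<rightarrow>\<^sub>E {- int L..int L}. (\<Sum>b\<in>B. \<bar>z b\<bar>) \<le> int L}" using finZ by (simp add: Z_def)
qed

lemma round_towards_zero:
  fixes y :: real
  obtains n :: int where "\<bar>y - of_int n\<bar> \<le> 1" "\<bar>of_int n\<bar> \<le> \<bar>y\<bar>"
proof (cases "y \<ge> 0")
  case True
  then show ?thesis by (intro that[of "\<lfloor>y\<rfloor>"]) (simp; linarith)+
next
  case False
  then show ?thesis by (intro that[of "\<lceil>y\<rceil>"]) (simp; linarith)+
qed

text \<open>
  The coordinates in an orthonormal basis are rounded towards zero to multiples of
  \<open>s = 1/(16\<surd>D)\<close>. This changes a vector by at most \<open>s\<surd>D = 1/16\<close> and does not increase its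
  norm. By Cauchy--Schwarz the rounded coordinates have l1 norm at most \<open>\<surd>D\<close>, so the
  integers that represent them have l1 norm at most \<open>16D\<close>. Counting with \<open>r = 15/16\<close> gives at most
  \<open>(31 (16/15)\<^bsup>16\<^esup>)\<^sup>D \<le> 88\<^sup>D\<close> points.
\<close>
lemma unit_ball_net:
  fixes V :: "'e::euclidean_space set"
  assumes "subspace V"
  obtains N where "finite N" "N \<subseteq> V \<inter> cball 0 1" "real (card N) \<le> 88 ^ dim V"
    "\<And>x. x \<in> V \<Longrightarrow> norm x \<le> 1 \<Longrightarrow> \<exists>p\<in>N. norm (x - p) \<le> 1 / 16"
proof (cases "dim V = 0")
  case True
  then have "V = {0}" using assms subspace_0[of V] dim_eq_0[of V] by blast
  then show thesis using that[of "{0}"] by simp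
next
  case False
  define D where "D = dim V"
  have V: "subspace V" "dim V = D" "1 \<le> D" using assms False by (auto simp: D_def simp del: dim_eq_0)
  obtain B where B: "B \<subseteq> V" "pairwise orthogonal B" "\<And>x. x \<in> B \<Longrightarrow> norm x = 1"
    "independent B" "card B = dim V" "span B = V"
    using orthonormal_basis_subspace[OF V(1)] by metis
  have finB: "finite B" using B(4) by (rule independent_imp_finite)
  define L where "L = 16 * D"
  define s where "s = 1 / (16 * sqrt (real D))"
  have s: "s > 0" using V by (simp add: s_def)
  define Z where "Z = {z \<in> B \<rightarrow>\<^sub>E {- int L..int L}. (\<Sum>b\<in>B. \<bar>z b\<bar>) \<le> int L}"
  define P where "P z = (\<Sum>b\<in>B. (s * of_int (z b)) *\<^sub>R b)" for z :: "'e \<Rightarrow> int"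
  define N where "N = {p \<in> P ` Z. norm p \<le> 1}"
  have norm_sum: "(norm (\<Sum>b\<in>B. c b *\<^sub>R b))\<^sup>2 = (\<Sum>b\<in>B. (c b)\<^sup>2)" for c :: "'e \<Rightarrow> real"
  proof -
    have "(norm (\<Sum>b\<in>B. c b *\<^sub>R b))\<^sup>2 = (\<Sum>b\<in>B. (norm (c b *\<^sub>R b))\<^sup>2)"
      using B(2) by (intro norm_sum_Pythagorean finB)
        (auto simp: pairwise_def orthogonal_clauses)
    then show ?thesis using B(3) by (simp add: power_mult_distrib)
  qed
  have Z: "finite Z" "real (card Z) * (15/16) ^ L \<le> 31 ^ D"
    using card_integer_points_l1_ball[OF finB, of "15/16" L] B(5) V(2) by (auto simp: Z_def)
  have "real (card N) \<le> real (card Z)"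
    using card_mono[of "P ` Z" N] card_image_le[OF Z(1), of P] Z(1) by (auto simp: N_def)
  also have "real (card Z) \<le> 88 ^ D"
  proof -
    have "(31::real) \<le> 88 * (15/16) ^ 16" by (simp add: power_divide)
    then have "(31::real) ^ D \<le> (88 * (15/16) ^ 16) ^ D" by (intro power_mono) auto
    also have "\<dots> = 88 ^ D * (15/16) ^ L" by (simp add: power_mult_distrib L_def power_mult)
    finally have "real (card Z) * (15/16) ^ L \<le> 88 ^ D * (15/16) ^ L" using Z(2) by linarith
    then show ?thesis by (rule mult_right_le_imp_le) simp
  qed
  finally have cardN: "real (card N) \<le> 88 ^ D" .
  have approx: "\<exists>p\<in>N. norm (x - p) \<le> 1 / 16" if x: "x \<in> V" "norm x \<le> 1" for x
  proof -
    define c where "c b = x \<bullet> b" for b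
    have x_eq: "x = (\<Sum>b\<in>B. c b *\<^sub>R b)"
      using orthonormal_basis_expand[OF B(2,3) _ finB, of x] B(6) x by (simp add: c_def)
    have "\<forall>b. \<exists>n::int. \<bar>c b / s - of_int n\<bar> \<le> 1 \<and> \<bar>of_int n\<bar> \<le> \<bar>c b / s\<bar>"
      by (meson round_towards_zero)
    then obtain n :: "'e \<Rightarrow> int" where n: "\<And>b. \<bar>c b / s - of_int (n b)\<bar> \<le> 1"
      "\<And>b. \<bar>of_int (n b)\<bar> \<le> \<bar>c b / s\<bar>" by metis
    have n1: "\<bar>c b - s * of_int (n b)\<bar> \<le> s" for b
    proof -
      have "c b - s * of_int (n b) = s * (c b / s - of_int (n b))" using s by (simp add: field_simps)
      then show ?thesis using mult_left_mono[OF n(1)[of b], of s] s by (simp add: abs_mult)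
    qed
    have n2: "s * \<bar>of_int (n b)\<bar> \<le> \<bar>c b\<bar>" for b
      using n(2)[of b] s by (simp add: abs_divide field_simps)
    define z where "z = restrict n B"
    have Pz: "P z = (\<Sum>b\<in>B. (s * of_int (n b)) *\<^sub>R b)" by (simp add: P_def z_def)
    have c2: "(\<Sum>b\<in>B. (c b)\<^sup>2) \<le> 1"
      unfolding norm_sum[symmetric] x_eq[symmetric] using x(2) by (simp add: power_le_one)
    have "s * (\<Sum>b\<in>B. \<bar>of_int (n b)\<bar>) \<le> (\<Sum>b\<in>B. \<bar>c b\<bar>)"
      unfolding sum_distrib_left by (intro sum_mono n2)
    also have "\<dots> \<le> sqrt ((\<Sum>b\<in>B. (c b)\<^sup>2) * real D)"
      using sum_squared_le_sum_of_squares[of "\<lambda>b. \<bar>c b\<bar>" B] B(5) V(2)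
      by (intro real_le_rsqrt) simp
    also have "\<dots> \<le> sqrt (real D)"
      using mult_right_mono[OF c2, of "real D"] by simp
    also have "\<dots> = s * real L"
      using V by (simp add: s_def L_def field_simps flip: power2_eq_square)
    finally have "real_of_int (\<Sum>b\<in>B. \<bar>n b\<bar>) \<le> real_of_int (int L)" using s by simp
    then have sumn: "(\<Sum>b\<in>B. \<bar>n b\<bar>) \<le> int L" by linarith
    have "\<bar>n b\<bar> \<le> int L" if "b \<in> B" for b
      using sumn member_le_sum[of b B "\<lambda>b. \<bar>n b\<bar>"] that finB by simp
    then have "z \<in> Z" using sumn by (auto simp: Z_def z_def abs_le_iff) (smt (verit))
    have "(norm (P z))\<^sup>2 \<le> 1"
    proof -
      have "(norm (P z))\<^sup>2 = (\<Sum>b\<in>B. (s * of_int (n b))\<^sup>2)" by (simp add: Pz norm_sum)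
      also have "\<dots> \<le> (\<Sum>b\<in>B. (c b)\<^sup>2)"
        using n2 s by (intro sum_mono abs_le_square_iff[THEN iffD1]) (simp add: abs_mult)
      finally show ?thesis using c2 by simp
    qed
    then have "norm (P z) \<le> 1" by (simp add: power_le_one_iff abs_square_le_1)
    moreover have "norm (x - P z) \<le> 1 / 16"
    proof (rule power2_le_imp_le)
      have "(norm (x - P z))\<^sup>2 = (\<Sum>b\<in>B. (c b - s * of_int (n b))\<^sup>2)"
        unfolding Pz by (subst x_eq) (simp add: norm_sum flip: sum_subtractf scaleR_left_diff_distrib)
      also have "\<dots> \<le> (\<Sum>b\<in>B. s\<^sup>2)"
        using n1 s by (intro sum_mono abs_le_square_iff[THEN iffD1]) simp
      also have "\<dots> = (1 / 16)\<^sup>2" using V B(5) by (simp add: s_def power_divide power_mult_distrib)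
      finally show "(norm (x - P z))\<^sup>2 \<le> (1 / 16)\<^sup>2" .
    qed simp
    ultimately show ?thesis using \<open>z \<in> Z\<close> by (auto simp: N_def)
  qed
  have "P z \<in> V" for z
    unfolding P_def using B V by (intro subspace_sum subspace_scale) auto
  then have "N \<subseteq> V \<inter> cball 0 1" by (auto simp: N_def)
  moreover have "finite N" using Z(1) by (simp add: N_def)
  ultimately show thesis using that cardN approx V(2) by blast
qed

text \<open>
  Let the defect \<open>q(x) = \<parallel>Tx\<parallel>\<^sup>2 - \<parallel>x\<parallel>\<^sup>2\<close> attain its maximal absolute value \<open>m\<close> on the unit ball of
  \<open>V\<close> at \<open>x\<^sub>0\<close>, and let \<open>p\<close> be a net point near \<open>x\<^sub>0\<close>. Polarization gives
  \<open>\<bar>q(x\<^sub>0) - q(p)\<bar> \<le> m \<parallel>x\<^sub>0 - p\<parallel> \<parallel>x\<^sub>0 + p\<parallel> \<le> m/8\<close>, hence \<open>m \<le> t + m/8\<close>.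
\<close>
lemma near_isometry_on_from_net:
  fixes T :: "'e::euclidean_space \<Rightarrow> 'y::real_inner"
  assumes T: "linear T" and V: "subspace V"
    and N: "N \<subseteq> V \<inter> cball 0 1" "\<And>x. x \<in> V \<Longrightarrow> norm x \<le> 1 \<Longrightarrow> \<exists>p\<in>N. norm (x - p) \<le> 1 / 16"
    and t: "\<And>p. p \<in> N \<Longrightarrow> \<bar>(norm (T p))\<^sup>2 - (norm p)\<^sup>2\<bar> \<le> t"
  shows "near_isometry_on V T (8 / 7 * t)"
proof -
  define q where "q x = (norm (T x))\<^sup>2 - (norm x)\<^sup>2" for x
  have "compact (V \<inter> cball 0 1)" using V by (intro closed_Int_compact closed_subspace) auto
  moreover have "0 \<in> V \<inter> cball 0 1" using V by (simp add: subspace_0)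
  moreover have "continuous_on (V \<inter> cball 0 1) (\<lambda>x. \<bar>q x\<bar>)"
    unfolding q_def using linear_continuous_on[OF linear_conv_bounded_linear[THEN iffD1, OF T]]
    by (intro continuous_intros) auto
  ultimately obtain x0 where x0: "x0 \<in> V" "norm x0 \<le> 1"
    and max: "\<And>x. x \<in> V \<Longrightarrow> norm x \<le> 1 \<Longrightarrow> \<bar>q x\<bar> \<le> \<bar>q x0\<bar>"
    using continuous_attains_sup[of "V \<inter> cball 0 1" "\<lambda>x. \<bar>q x\<bar>"] by (metis IntE IntI empty_iff mem_cball_0)
  define m where "m = \<bar>q x0\<bar>"
  have scale: "\<bar>q x\<bar> \<le> m * (norm x)\<^sup>2" if "x \<in> V" for x
  proof (cases "x = 0")
    case False
    have "q x = (norm x)\<^sup>2 * q (x /\<^sub>R norm x)"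
      using False by (simp add: q_def linear_scale[OF T] power_mult_distrib field_simps)
    moreover have "\<bar>q (x /\<^sub>R norm x)\<bar> \<le> m"
      unfolding m_def using False V that by (intro max subspace_scale) auto
    ultimately show ?thesis
      using mult_left_mono[of "\<bar>q (x /\<^sub>R norm x)\<bar>" m "(norm x)\<^sup>2"] by (simp add: abs_mult mult.commute)
  qed (simp add: q_def linear_0[OF T])
  then have near: "near_isometry_on V T m" by (simp add: near_isometry_on_def q_def)
  obtain p where p: "p \<in> N" "norm (x0 - p) \<le> 1 / 16" using N(2) x0 by blast
  then have pV: "p \<in> V" "norm p \<le> 1" using N(1) by auto
  have "q x0 - q p = inner (T (x0 - p)) (T (x0 + p)) - inner (x0 - p) (x0 + p)"
    by (simp add: q_def linear_add[OF T] linear_diff[OF T] power2_norm_eq_inner inner_commute algebra_simps)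
  then have "\<bar>q x0 - q p\<bar> \<le> m * norm (x0 - p) * norm (x0 + p)"
    using near_isometry_inner[OF near T V, of "x0 - p" "x0 + p"] V x0 pV
    by (simp add: subspace_add subspace_diff)
  also have "\<dots> \<le> m * (1 / 16) * 2"
    using p(2) x0 pV norm_triangle_ineq[of x0 p] by (intro mult_mono) (auto simp: m_def)
  finally have "\<bar>q x0 - q p\<bar> \<le> m / 8" by simp
  moreover have "\<bar>q p\<bar> \<le> t" using t p by (simp add: q_def)
  ultimately have "m \<le> 8 / 7 * t" unfolding m_def by linarith
  then have "m * (norm x)\<^sup>2 \<le> 8 / 7 * t * (norm x)\<^sup>2" for x :: 'e by (intro mult_right_mono) auto
  then show ?thesis
    using near unfolding near_isometry_on_def by (meson order_trans)
qed

section \<open>Concentration of the norm under Gaussian matrices\<close>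

text \<open>
  The moment generating function of the square of a standard Gaussian. The integrand is, up to the
  factor \<open>1/c\<close> with \<open>c = \<surd>(1 - 2\<theta>)\<close>, again a centred Gaussian density.
\<close>
lemma nn_integral_exp_square_normal:
  assumes Y: "distributed M lborel Y (\<lambda>x. ennreal (normal_density 0 \<sigma> x))"
    and "0 < \<sigma>" "\<theta> < 1 / 2"
  shows "(\<integral>\<^sup>+\<omega>. ennreal (exp (\<theta> * (Y \<omega>)\<^sup>2 / \<sigma>\<^sup>2)) \<partial>M) = ennreal (1 / sqrt (1 - 2 * \<theta>))"
proof -
  define c where "c = sqrt (1 - 2 * \<theta>)"
  have c: "c > 0" "c\<^sup>2 = 1 - 2 * \<theta>" using assms by (simp_all add: c_def)
  have dens: "normal_density 0 \<sigma> x * exp (\<theta> * x\<^sup>2 / \<sigma>\<^sup>2) = 1 / c * normal_density 0 (\<sigma> / c) x" for x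
  proof -
    have "exp (- x\<^sup>2 / (2 * \<sigma>\<^sup>2)) * exp (\<theta> * x\<^sup>2 / \<sigma>\<^sup>2) = exp (- x\<^sup>2 / (2 * (\<sigma> / c)\<^sup>2))"
    proof -
      have \<theta>: "\<theta> = (1 - c\<^sup>2) / 2" using c(2) by simp
      show ?thesis unfolding \<theta>
        using assms(2) c(1) by (simp add: power_divide field_simps flip: exp_add)
    qed
    moreover have "1 / sqrt (2 * pi * \<sigma>\<^sup>2) = 1 / c * (1 / sqrt (2 * pi * (\<sigma> / c)\<^sup>2))"
      using assms(2) c(1) by (simp add: power_divide real_sqrt_mult real_sqrt_divide)
    ultimately show ?thesis by (simp add: normal_density_def)
  qed
  interpret N: prob_space "density lborel (\<lambda>x. ennreal (normal_density 0 (\<sigma> / c) x))"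
    using assms c by (intro prob_space_normal_density) simp
  have one: "(\<integral>\<^sup>+x. ennreal (normal_density 0 (\<sigma> / c) x) \<partial>lborel) = 1"
    using N.emeasure_space_1 by (simp add: emeasure_density)
  have "(\<integral>\<^sup>+\<omega>. ennreal (exp (\<theta> * (Y \<omega>)\<^sup>2 / \<sigma>\<^sup>2)) \<partial>M)
      = (\<integral>\<^sup>+x. ennreal (normal_density 0 \<sigma> x) * ennreal (exp (\<theta> * x\<^sup>2 / \<sigma>\<^sup>2)) \<partial>lborel)"
    by (rule distributed_nn_integral[OF Y, symmetric]) simp
  also have "\<dots> = (\<integral>\<^sup>+x. ennreal (1 / c) * ennreal (normal_density 0 (\<sigma> / c) x) \<partial>lborel)"
    by (intro nn_integral_cong) (use c in \<open>simp add: dens flip: ennreal_mult\<close>)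
  also have "\<dots> = ennreal (1 / c)"
    by (subst nn_integral_cmult) (simp_all add: one)
  finally show ?thesis by (simp add: c_def)
qed

lemma (in prob_space) indep_vars_reindex:
  assumes h: "inj_on h I" and ind: "indep_vars M' X (h ` I)"
  shows "indep_vars (\<lambda>i. M' (h i)) (\<lambda>i. X (h i)) I"
  unfolding indep_vars_def2
proof (intro conjI ballI indep_setsI)
  show "random_variable (M' (h i)) (X (h i))" if "i \<in> I" for i
    using ind that by (auto simp: indep_vars_def2)
  show "{X (h i) -` A \<inter> space M |A. A \<in> sets (M' (h i))} \<subseteq> events" if "i \<in> I" for i
    using ind that by (auto simp: indep_vars_def2)
  fix A J assume J: "J \<noteq> {}" "J \<subseteq> I" "finite J"
    and A: "\<forall>j\<in>J. A j \<in> {X (h j) -` A \<inter> space M |A. A \<in> sets (M' (h j))}"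
  have inv: "the_inv_into I h (h j) = j" if "j \<in> J" for j
    using the_inv_into_f_f[OF h] that J by auto
  have "prob (\<Inter>j\<in>h ` J. A (the_inv_into I h j)) = (\<Prod>j\<in>h ` J. prob (A (the_inv_into I h j)))"
    using ind J A inv by (intro indep_setsD[where I = "h ` I"]) (auto simp: indep_vars_def2)
  also have "\<dots> = (\<Prod>j\<in>J. prob (A j))"
    using inv inj_on_subset[OF h J(2)] by (simp add: prod.reindex)
  finally show "prob (\<Inter>j\<in>J. A j) = (\<Prod>j\<in>J. prob (A j))" using inv by simp
qed

text \<open>
  Terms with coefficient zero are degenerate Gaussians without a density and are removed before
  independent Gaussians are added.
\<close>
lemma (in prob_space) linear_combination_normal:
  fixes g :: "'p::finite \<Rightarrow> 'a \<Rightarrow> real"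
  assumes ind: "indep_vars (\<lambda>_. borel) g UNIV"
    and g: "\<And>j. distributed M lborel (g j) (\<lambda>x. ennreal (normal_density 0 \<sigma> x))"
    and \<sigma>: "0 < \<sigma>" and c: "(\<Sum>j\<in>UNIV. (c j)\<^sup>2) > 0"
  shows "distributed M lborel (\<lambda>\<omega>. \<Sum>j\<in>UNIV. g j \<omega> * c j)
      (\<lambda>x. ennreal (normal_density 0 (\<sigma> * sqrt (\<Sum>j\<in>UNIV. (c j)\<^sup>2)) x))"
proof -
  define J where "J = {j. c j \<noteq> 0}"
  have "J \<noteq> {}" using c by (auto simp: J_def intro: ccontr)
  have "indep_vars (\<lambda>_. borel) g J" using ind indep_vars_subset by blast
  then have indJ: "indep_vars (\<lambda>_. borel) (\<lambda>j \<omega>. c j * g j \<omega>) J"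
    by (rule indep_vars_compose2) simp
  have "distributed M lborel (\<lambda>\<omega>. c j * g j \<omega>) (\<lambda>x. ennreal (normal_density 0 (\<bar>c j\<bar> * \<sigma>) x))" if "j \<in> J" for j
    using normal_density_affine[OF g \<sigma>, of "c j" 0 j] that by (simp add: J_def)
  then have "distributed M lborel (\<lambda>\<omega>. \<Sum>j\<in>J. c j * g j \<omega>)
      (normal_density (\<Sum>j\<in>J. 0) (sqrt (\<Sum>j\<in>J. (\<bar>c j\<bar> * \<sigma>)\<^sup>2)))"
    using \<sigma> by (intro sum_indep_normal indJ \<open>J \<noteq> {}\<close>) (auto simp: J_def)
  moreover have "(\<Sum>j\<in>J. (\<bar>c j\<bar> * \<sigma>)\<^sup>2) = \<sigma>\<^sup>2 * (\<Sum>j\<in>UNIV. (c j)\<^sup>2)"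
    unfolding sum_distrib_left by (rule sum.mono_neutral_cong_left) (auto simp: J_def power_mult_distrib)
  moreover have "(\<Sum>j\<in>J. c j * g j \<omega>) = (\<Sum>j\<in>UNIV. g j \<omega> * c j)" for \<omega>
    by (rule sum.mono_neutral_cong_left) (auto simp: J_def)
  ultimately show ?thesis using \<sigma> by (simp add: real_sqrt_mult)
qed

text \<open>
  In an orthonormal basis, \<open>\<parallel>\<Sum>\<^sub>j g\<^sub>j v\<^sub>j\<parallel>\<^sup>2 / \<sigma>\<^sup>2 = \<Sum>\<^sub>b w\<^sub>b \<xi>\<^sub>b\<^sup>2\<close>, where \<open>w\<^sub>b = \<Sum>\<^sub>j \<langle>v\<^sub>j, b\<rangle>\<^sup>2\<close>
  has total mass one and each \<open>\<xi>\<^sub>b\<close> is a standard Gaussian. The \<open>\<xi>\<^sub>b\<close> may be dependent: Jensen's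
  inequality for the weights \<open>w\<^sub>b\<close> bounds the exponential by a convex combination, and each term
  has the same expectation.
\<close>
lemma (in prob_space) nn_integral_exp_norm_gaussian_le:
  fixes g :: "'p::finite \<Rightarrow> 'a \<Rightarrow> real" and v :: "'p \<Rightarrow> 'e::euclidean_space"
  assumes ind: "indep_vars (\<lambda>_. borel) g UNIV"
    and g: "\<And>j. distributed M lborel (g j) (\<lambda>x. ennreal (normal_density 0 \<sigma> x))"
    and \<sigma>: "0 < \<sigma>" and v: "(\<Sum>j\<in>UNIV. (norm (v j))\<^sup>2) = 1" and l: "\<theta> < 1 / 2"
  shows "(\<integral>\<^sup>+\<omega>. ennreal (exp (\<theta> * (norm (\<Sum>j\<in>UNIV. g j \<omega> *\<^sub>R v j))\<^sup>2 / \<sigma>\<^sup>2)) \<partial>M)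
      \<le> ennreal (1 / sqrt (1 - 2 * \<theta>))"
proof -
  define w where "w b = (\<Sum>j\<in>UNIV. (v j \<bullet> b)\<^sup>2)" for b
  define Y where "Y b \<omega> = (\<Sum>j\<in>UNIV. g j \<omega> * (v j \<bullet> b))" for b \<omega>
  have [measurable]: "g j \<in> borel_measurable M" for j using g distributed_real_measurable
    by (metis distributed_measurable measurable_lborel1)
  have [measurable]: "Y b \<in> borel_measurable M" for b unfolding Y_def by measurable
  have w0: "w b \<ge> 0" for b by (simp add: w_def sum_nonneg)
  have w1: "(\<Sum>b\<in>Basis. w b) = 1"
  proof -
    have "(\<Sum>b\<in>Basis. w b) = (\<Sum>j\<in>UNIV. \<Sum>b\<in>Basis. (v j \<bullet> b)\<^sup>2)" unfolding w_def by (rule sum.swap)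
    also have "\<dots> = (\<Sum>j\<in>UNIV. (norm (v j))\<^sup>2)"
      by (simp add: norm_eq_sqrt_inner euclidean_inner[of "v _" "v _"] sum_nonneg power2_eq_square)
    finally show ?thesis using v by simp
  qed
  have normY: "(norm (\<Sum>j\<in>UNIV. g j \<omega> *\<^sub>R v j))\<^sup>2 = (\<Sum>b\<in>Basis. (Y b \<omega>)\<^sup>2)" for \<omega>
    unfolding power2_norm_eq_inner by (subst euclidean_inner) (simp add: Y_def inner_sum_left power2_eq_square)
  \<comment> \<open>If \<open>w b = 0\<close>, the quotients by \<open>w b\<close> below are zero by convention, and so is the term they stand for.\<close>
  have Y0: "Y b \<omega> = 0" if "w b = 0" for b \<omega>
    using that unfolding w_def Y_def by (subst (asm) sum_nonneg_eq_0_iff) auto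
  have point: "exp (\<theta> * (norm (\<Sum>j\<in>UNIV. g j \<omega> *\<^sub>R v j))\<^sup>2 / \<sigma>\<^sup>2)
      \<le> (\<Sum>b\<in>Basis. w b * exp (\<theta> * (Y b \<omega>)\<^sup>2 / (\<sigma> * sqrt (w b))\<^sup>2))" for \<omega>
  proof -
    have eq: "\<theta> * (norm (\<Sum>j\<in>UNIV. g j \<omega> *\<^sub>R v j))\<^sup>2 / \<sigma>\<^sup>2
        = (\<Sum>b\<in>Basis. w b *\<^sub>R (\<theta> * (Y b \<omega>)\<^sup>2 / (\<sigma> * sqrt (w b))\<^sup>2))"
      unfolding normY sum_distrib_left sum_divide_distrib
      using w0 Y0 by (intro sum.cong refl) (auto simp: power_mult_distrib)
    show ?thesis unfolding eq
      by (rule convex_on_sum[OF finite_Basis nonempty_Basis exp_convex w1 w0]) simp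
  qed
  have summand: "ennreal (w b) * (\<integral>\<^sup>+\<omega>. ennreal (exp (\<theta> * (Y b \<omega>)\<^sup>2 / (\<sigma> * sqrt (w b))\<^sup>2)) \<partial>M)
      = ennreal (w b * (1 / sqrt (1 - 2 * \<theta>)))" for b
  proof (cases "w b = 0")
    case False
    then have "w b > 0" using w0[of b] by simp
    then have "distributed M lborel (Y b) (\<lambda>x. ennreal (normal_density 0 (\<sigma> * sqrt (w b)) x))"
      unfolding Y_def w_def by (intro linear_combination_normal ind g \<sigma>)
    then have *: "(\<integral>\<^sup>+\<omega>. ennreal (exp (\<theta> * (Y b \<omega>)\<^sup>2 / (\<sigma> * sqrt (w b))\<^sup>2)) \<partial>M) = ennreal (1 / sqrt (1 - 2 * \<theta>))"
      using \<open>w b > 0\<close> \<sigma> by (intro nn_integral_exp_square_normal l) auto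
    show ?thesis unfolding * using w0[of b] l by (subst ennreal_mult) auto
  qed simp
  have "(\<integral>\<^sup>+\<omega>. ennreal (exp (\<theta> * (norm (\<Sum>j\<in>UNIV. g j \<omega> *\<^sub>R v j))\<^sup>2 / \<sigma>\<^sup>2)) \<partial>M)
      \<le> (\<integral>\<^sup>+\<omega>. (\<Sum>b\<in>Basis. ennreal (w b) * ennreal (exp (\<theta> * (Y b \<omega>)\<^sup>2 / (\<sigma> * sqrt (w b))\<^sup>2))) \<partial>M)"
    using w0 point by (intro nn_integral_mono) (simp flip: ennreal_mult add: ennreal_leI)
  also have "\<dots> = (\<Sum>b\<in>Basis. ennreal (w b) * (\<integral>\<^sup>+\<omega>. ennreal (exp (\<theta> * (Y b \<omega>)\<^sup>2 / (\<sigma> * sqrt (w b))\<^sup>2)) \<partial>M))"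
    by (simp add: nn_integral_sum nn_integral_cmult)
  also have "\<dots> = (\<Sum>b\<in>Basis. ennreal (w b * (1 / sqrt (1 - 2 * \<theta>))))" unfolding summand ..
  also have "\<dots> = ennreal (\<Sum>b\<in>Basis. w b * (1 / sqrt (1 - 2 * \<theta>)))"
    using w0 l by (intro sum_ennreal) simp
  also have "(\<Sum>b\<in>Basis. w b * (1 / sqrt (1 - 2 * \<theta>))) = 1 / sqrt (1 - 2 * \<theta>)"
    unfolding sum_distrib_right[symmetric] w1 by simp
  finally show ?thesis .
qed

text \<open>
  After squaring, with \<open>y = 2\<theta>\<close>, the claim becomes \<open>e\<^bsup>-(y + y\<^sup>2)\<^esup> \<le> 1 - y\<close> for \<open>\<bar>y\<bar> \<le> 1/2\<close>. For
  \<open>y \<ge> 0\<close> it follows from the quadratic Taylor bound for the exponential, and for \<open>y < 0\<close> from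
  \<open>ln (1 + x) \<ge> x - x\<^sup>2\<close> with \<open>x = -y\<close>.
\<close>
lemma chi_square_exponent_bound:
  fixes \<theta> :: real
  assumes "\<bar>\<theta>\<bar> \<le> 1 / 4"
  shows "exp (- \<theta>) / sqrt (1 - 2 * \<theta>) \<le> exp (2 * \<theta>\<^sup>2)"
proof -
  define y where "y = 2 * \<theta>"
  have y: "\<bar>y\<bar> \<le> 1 / 2" using assms by (simp add: y_def)
  have *: "exp (- (y + y\<^sup>2)) \<le> 1 - y"
  proof (cases "y \<ge> 0")
    case True
    define u where "u = y + y\<^sup>2"
    have "u \<ge> 0" using True by (simp add: u_def)
    have "y \<le> 1 / 2" using y by simp
    then have "y\<^sup>2 \<le> (1/2)\<^sup>2" "y^3 \<le> (1/2)^3" using True by (auto intro!: power_mono)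
    then have "y + y\<^sup>2 + y^3 \<le> 1" using y by (simp add: power_divide)
    then have "y * y * (y + y\<^sup>2 + y^3) \<le> y * y * 1" by (rule mult_left_mono) simp
    then have "1 \<le> (1 - y) * (1 + u + u\<^sup>2 / 2)"
      by (simp add: u_def algebra_simps power2_eq_square power3_eq_cube)
    also have "\<dots> \<le> (1 - y) * exp u"
      using exp_lower_Taylor_quadratic[OF \<open>u \<ge> 0\<close>] y by (intro mult_left_mono) auto
    finally show ?thesis unfolding u_def[symmetric] by (simp add: exp_minus field_simps)
  next
    case False
    then have "\<bar>ln (1 + (- y)) - (- y)\<bar> \<le> (- y)\<^sup>2"
      using y by (intro abs_ln_one_plus_x_minus_x_bound_nonneg) auto
    then have "- (y + y\<^sup>2) \<le> ln (1 - y)" by simp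
    then have "exp (- (y + y\<^sup>2)) \<le> exp (ln (1 - y))" by (simp only: exp_le_cancel_iff)
    then show ?thesis using False by simp
  qed
  have pos: "sqrt (1 - y) > 0" using y by simp
  have "exp (- y / 2 - y\<^sup>2 / 2) = sqrt (exp (- (y + y\<^sup>2)))"
    by (rule real_sqrt_unique[symmetric]) (simp_all add: field_simps flip: exp_double)
  also have "\<dots> \<le> sqrt (1 - y)" using * by simp
  finally have "exp (- y / 2 - y\<^sup>2 / 2) * exp (y\<^sup>2 / 2) \<le> sqrt (1 - y) * exp (y\<^sup>2 / 2)"
    by (intro mult_right_mono) auto
  then have "exp (- y / 2) \<le> exp (y\<^sup>2 / 2) * sqrt (1 - y)" by (simp add: mult.commute flip: exp_add)
  then have "exp (- y / 2) / sqrt (1 - y) \<le> exp (y\<^sup>2 / 2)" using pos by (simp add: pos_divide_le_eq)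
  then show ?thesis by (simp add: y_def power_mult_distrib)
qed

text \<open>The rows of the matrix are independent, so the bounds for single rows multiply.\<close>
lemma (in prob_space) nn_integral_exp_gaussian_matrix_le:
  fixes S :: "'a \<Rightarrow> real^'p^'k" and v :: "'p \<Rightarrow> 'e::euclidean_space"
  assumes S: "rescaled_gaussian M S"
    and v: "(\<Sum>j\<in>UNIV. (norm (v j))\<^sup>2) = 1" and l: "\<bar>\<theta>\<bar> \<le> 1 / 4"
  shows "(\<integral>\<^sup>+\<omega>. ennreal (exp (\<theta> * real CARD('k) *
             ((\<Sum>i\<in>UNIV. (norm (\<Sum>j\<in>UNIV. S \<omega> $ i $ j *\<^sub>R v j))\<^sup>2) - 1))) \<partial>M)
      \<le> ennreal (exp (2 * \<theta>\<^sup>2 * real CARD('k)))"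
proof -
  define k where "k = real CARD('k)"
  define \<sigma> where "\<sigma> = sqrt (1 / k)"
  have k: "k > 0" by (simp add: k_def)
  have \<sigma>: "\<sigma> > 0" "\<sigma>\<^sup>2 = 1 / k" using k by (simp_all add: \<sigma>_def)
  have ind: "indep_vars (\<lambda>_. borel) (\<lambda>(i, j) \<omega>. S \<omega> $ i $ j) UNIV"
    and gauss: "\<And>i j. distributed M lborel (\<lambda>\<omega>. S \<omega> $ i $ j) (\<lambda>x. ennreal (normal_density 0 \<sigma> x))"
    using S by (simp_all add: rescaled_gaussian_def \<sigma>_def k_def)
  define f :: "'k \<Rightarrow> ('k \<times> 'p \<Rightarrow> real) \<Rightarrow> ennreal" where
    "f i s = ennreal (exp (- \<theta>) * exp (\<theta> * (norm (\<Sum>j\<in>UNIV. s (i, j) *\<^sub>R v j))\<^sup>2 / \<sigma>\<^sup>2))" for i s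
  \<comment> \<open>Grouping the independent entries into rows makes the factors \<open>f i\<close> independent.\<close>
  define K where "K i = {i} \<times> (UNIV :: 'p set)" for i :: 'k
  have "indep_vars (\<lambda>i. PiM (K i) (\<lambda>_. borel))
      (\<lambda>i \<omega>. restrict (\<lambda>ij. (case ij of (i, j) \<Rightarrow> \<lambda>\<omega>. S \<omega> $ i $ j) \<omega>) (K i)) UNIV"
    by (rule indep_vars_restrict[OF ind]) (auto simp: K_def disjoint_family_on_def)
  then have "indep_vars (\<lambda>_. borel) (\<lambda>i \<omega>. f i
      (restrict (\<lambda>ij. (case ij of (i, j) \<Rightarrow> \<lambda>\<omega>. S \<omega> $ i $ j) \<omega>) (K i))) UNIV"
  proof (rule indep_vars_compose2)
    fix i :: 'k
    have [measurable]: "(\<lambda>s. s (i, j)) \<in> borel_measurable (PiM (K i) (\<lambda>_. borel :: real measure))" for j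
      by (rule measurable_component_singleton) (simp add: K_def)
    show "f i \<in> borel_measurable (PiM (K i) (\<lambda>_. borel :: real measure))"
      unfolding f_def by measurable
  qed
  then have indf: "indep_vars (\<lambda>_. borel) (\<lambda>i \<omega>. f i (\<lambda>(i, j). S \<omega> $ i $ j)) UNIV"
    by (simp add: f_def K_def)
  have row: "(\<integral>\<^sup>+\<omega>. f i (\<lambda>(i, j). S \<omega> $ i $ j) \<partial>M) \<le> ennreal (exp (2 * \<theta>\<^sup>2))" for i
  proof -
    have ind_i: "indep_vars (\<lambda>_. borel) (\<lambda>j \<omega>. S \<omega> $ i $ j) UNIV"
      using indep_vars_reindex[OF _ indep_vars_subset[OF ind], of "Pair i" UNIV] by (simp add: inj_on_def)
    have meas: "(\<lambda>\<omega>. S \<omega> $ i $ j) \<in> borel_measurable M" for j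
      using gauss by (metis distributed_measurable measurable_lborel1)
    have "(\<integral>\<^sup>+\<omega>. f i (\<lambda>(i, j). S \<omega> $ i $ j) \<partial>M) = ennreal (exp (- \<theta>)) *
       (\<integral>\<^sup>+\<omega>. ennreal (exp (\<theta> * (norm (\<Sum>j\<in>UNIV. S \<omega> $ i $ j *\<^sub>R v j))\<^sup>2 / \<sigma>\<^sup>2)) \<partial>M)"
      unfolding f_def using meas by (subst nn_integral_cmult[symmetric]) (simp_all add: ennreal_mult)
    also have "\<dots> \<le> ennreal (exp (- \<theta>)) * ennreal (1 / sqrt (1 - 2 * \<theta>))"
      using l by (intro mult_left_mono nn_integral_exp_norm_gaussian_le ind_i gauss \<sigma> v) auto
    also have "\<dots> = ennreal (exp (- \<theta>) / sqrt (1 - 2 * \<theta>))" by (simp add: ennreal_mult'[symmetric])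
    also have "\<dots> \<le> ennreal (exp (2 * \<theta>\<^sup>2))" by (intro ennreal_leI chi_square_exponent_bound l)
    finally show ?thesis .
  qed
  have "exp (\<theta> * k * ((\<Sum>i\<in>UNIV. (norm (\<Sum>j\<in>UNIV. S \<omega> $ i $ j *\<^sub>R v j))\<^sup>2) - 1))
      = (\<Prod>i\<in>(UNIV::'k set). exp (- \<theta>) * exp (\<theta> * (norm (\<Sum>j\<in>UNIV. S \<omega> $ i $ j *\<^sub>R v j))\<^sup>2 / \<sigma>\<^sup>2))" for \<omega>
    by (simp add: \<sigma> k_def algebra_simps sum_subtractf sum_distrib_left flip: exp_add exp_sum)
  then have "(\<integral>\<^sup>+\<omega>. ennreal (exp (\<theta> * k * ((\<Sum>i\<in>UNIV. (norm (\<Sum>j\<in>UNIV. S \<omega> $ i $ j *\<^sub>R v j))\<^sup>2) - 1))) \<partial>M)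
      = (\<integral>\<^sup>+\<omega>. (\<Prod>i\<in>UNIV. f i (\<lambda>(i, j). S \<omega> $ i $ j)) \<partial>M)"
    by (simp add: f_def prod_ennreal)
  also have "\<dots> = (\<Prod>i\<in>UNIV. \<integral>\<^sup>+\<omega>. f i (\<lambda>(i, j). S \<omega> $ i $ j) \<partial>M)"
    by (rule indep_vars_nn_integral[OF _ indf]) auto
  also have "\<dots> \<le> (\<Prod>i\<in>(UNIV::'k set). ennreal (exp (2 * \<theta>\<^sup>2)))" by (intro prod_mono_ennreal row)
  also have "\<dots> = ennreal (exp (2 * \<theta>\<^sup>2 * k))"
    by (simp add: k_def ennreal_power exp_of_nat_mult mult.commute)
  finally show ?thesis by (simp add: k_def)
qed

text \<open>Chernoff's bound in both directions; \<open>\<theta> = t/4\<close> minimizes \<open>-\<theta> t + 2\<theta>\<^sup>2\<close>.\<close>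
lemma (in prob_space) gaussian_matrix_concentration:
  fixes S :: "'a \<Rightarrow> real^'p^'k" and v :: "'p \<Rightarrow> 'e::euclidean_space"
  assumes S: "rescaled_gaussian M S"
    and v: "(\<Sum>j\<in>UNIV. (norm (v j))\<^sup>2) = 1" and t: "0 < t" "t \<le> 1"
  shows "prob {\<omega>\<in>space M. \<bar>(\<Sum>i\<in>UNIV. (norm (\<Sum>j\<in>UNIV. S \<omega> $ i $ j *\<^sub>R v j))\<^sup>2) - 1\<bar> \<ge> t}
      \<le> 2 * exp (- real CARD('k) * t\<^sup>2 / 8)"
proof -
  define k where "k = real CARD('k)"
  have k: "k > 0" by (simp add: k_def)
  have [measurable]: "(\<lambda>\<omega>. S \<omega> $ i $ j) \<in> borel_measurable M" for i j
    using S unfolding rescaled_gaussian_def by (metis distributed_measurable measurable_lborel1)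
  define F where "F \<omega> = (\<Sum>i\<in>UNIV. (norm (\<Sum>j\<in>UNIV. S \<omega> $ i $ j *\<^sub>R v j))\<^sup>2) - 1" for \<omega>
  have [measurable]: "F \<in> borel_measurable M" unfolding F_def by measurable
  have mgf: "(\<integral>\<^sup>+\<omega>. ennreal (exp (\<theta> * k * F \<omega>)) \<partial>M) \<le> ennreal (exp (2 * \<theta>\<^sup>2 * k))" if "\<bar>\<theta>\<bar> \<le> 1 / 4" for \<theta>
    unfolding F_def k_def by (rule nn_integral_exp_gaussian_matrix_le[OF S v that])
  have expo: "exp (- (t / 4 * k) * t) * exp (2 * (t / 4)\<^sup>2 * k) = exp (- k * t\<^sup>2 / 8)"
    by (simp add: power2_eq_square field_simps flip: exp_add)
  have "emeasure M {\<omega>\<in>space M. F \<omega> \<ge> t} \<le>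
      ennreal (exp (- (t / 4 * k) * t)) * (\<integral>\<^sup>+\<omega>. ennreal (exp (t / 4 * k * F \<omega>)) * indicator (space M) \<omega> \<partial>M)"
    using t k by (intro Chernoff_ineq_nn_integral_ge) auto
  also have "(\<integral>\<^sup>+\<omega>. ennreal (exp (t / 4 * k * F \<omega>)) * indicator (space M) \<omega> \<partial>M)
      = (\<integral>\<^sup>+\<omega>. ennreal (exp (t / 4 * k * F \<omega>)) \<partial>M)" by (intro nn_integral_cong) simp
  also have "ennreal (exp (- (t / 4 * k) * t)) * \<dots>
      \<le> ennreal (exp (- (t / 4 * k) * t)) * ennreal (exp (2 * (t / 4)\<^sup>2 * k))"
    using t by (intro mult_left_mono mgf) auto
  also have "\<dots> = ennreal (exp (- k * t\<^sup>2 / 8))" using expo by (simp flip: ennreal_mult')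
  finally have upper: "prob {\<omega>\<in>space M. F \<omega> \<ge> t} \<le> exp (- k * t\<^sup>2 / 8)"
    by (simp add: emeasure_eq_measure)
  have "emeasure M {\<omega>\<in>space M. F \<omega> \<le> - t} \<le>
      ennreal (exp ((t / 4 * k) * (- t))) * (\<integral>\<^sup>+\<omega>. ennreal (exp (- (t / 4 * k) * F \<omega>)) * indicator (space M) \<omega> \<partial>M)"
    using t k by (intro Chernoff_ineq_nn_integral_le) auto
  also have "(\<integral>\<^sup>+\<omega>. ennreal (exp (- (t / 4 * k) * F \<omega>)) * indicator (space M) \<omega> \<partial>M)
      = (\<integral>\<^sup>+\<omega>. ennreal (exp ((- (t / 4)) * k * F \<omega>)) \<partial>M)" by (intro nn_integral_cong) simp
  also have "ennreal (exp ((t / 4 * k) * (- t))) * \<dots>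
      \<le> ennreal (exp ((t / 4 * k) * (- t))) * ennreal (exp (2 * (- (t / 4))\<^sup>2 * k))"
    using t by (intro mult_left_mono mgf) auto
  also have "\<dots> = ennreal (exp (- k * t\<^sup>2 / 8))"
    using expo by (simp flip: ennreal_mult')
  finally have lower: "prob {\<omega>\<in>space M. F \<omega> \<le> - t} \<le> exp (- k * t\<^sup>2 / 8)"
    by (simp add: emeasure_eq_measure)
  have "{\<omega>\<in>space M. \<bar>F \<omega>\<bar> \<ge> t} = {\<omega>\<in>space M. F \<omega> \<ge> t} \<union> {\<omega>\<in>space M. F \<omega> \<le> - t}" by auto
  then have "prob {\<omega>\<in>space M. \<bar>F \<omega>\<bar> \<ge> t} \<le> prob {\<omega>\<in>space M. F \<omega> \<ge> t} + prob {\<omega>\<in>space M. F \<omega> \<le> - t}"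
    by (simp add: measure_Un_le)
  then show ?thesis using upper lower by (simp add: F_def k_def)
qed

section \<open>Gaussian matrices as subspace embeddings\<close>

lemma adjoint_of_real_matrix:
  "adjoint_matrix (map_matrix of_real s :: 'a::scalar_field^'p^'k) = (\<chi> j i. of_real (s $ i $ j))"
  by (simp add: adjoint_matrix_def map_matrix_def transpose_def vec_eq_iff)

lemma norm_squared_columns:
  "(norm (A :: 'a::real_normed_vector^'n^'m))\<^sup>2 = (\<Sum>j\<in>UNIV. (norm (column j A))\<^sup>2)"
proof -
  have "(norm A)\<^sup>2 = (\<Sum>i\<in>UNIV. \<Sum>j\<in>UNIV. (norm (A $ i $ j))\<^sup>2)"
    by (simp add: norm_vec_def L2_set_def sum_nonneg)
  also have "\<dots> = (\<Sum>j\<in>UNIV. \<Sum>i\<in>UNIV. (norm (A $ i $ j))\<^sup>2)" by (rule sum.swap)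
  finally show ?thesis by (simp add: norm_vec_def L2_set_def sum_nonneg column_def)
qed

lemma column_mult_adjoint_real:
  "column i (X ** adjoint_matrix (map_matrix of_real s)) = (\<Sum>j\<in>UNIV. s $ i $ j *\<^sub>R column j (X :: 'a::scalar_field^'p^'q))"
  by (simp add: adjoint_of_real_matrix matrix_matrix_mult_def column_def vec_eq_iff scaleR_conv_of_real[where 'a='a] mult.commute)

lemma linear_mult_adjoint_real:
  "Vector_Spaces.linear scale_matrix scale_matrix (\<lambda>X. X ** (B :: 'a::scalar_field^'k^'p) :: 'a^'k^'q)"
proof -
  interpret F: compatible_inner_product scale_matrix "frobenius_inner :: 'a^'p^'q \<Rightarrow> _"
    by (rule frobenius_inner_product)
  interpret G: compatible_inner_product scale_matrix "frobenius_inner :: 'a^'k^'q \<Rightarrow> _"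
    by (rule frobenius_inner_product)
  show ?thesis
    by unfold_locales (simp_all add: scale_matrix_def map_matrix_def matrix_matrix_mult_def vec_eq_iff
        sum.distrib algebra_simps sum_distrib_left)
qed

text \<open>
  All events considered below are preimages of closed sets, which makes them measurable although
  they quantify over uncountably many vectors.
\<close>
lemma closed_near_isometry_on_image:
  fixes T :: "'s::topological_space \<Rightarrow> 'z::real_normed_vector \<Rightarrow> 'y::real_normed_vector" and U :: "'s \<Rightarrow> 'x \<Rightarrow> 'z"
  assumes "\<And>x. x \<in> V \<Longrightarrow> continuous_on UNIV (\<lambda>s. U s x)" "\<And>x. x \<in> V \<Longrightarrow> continuous_on UNIV (\<lambda>s. T s (U s x))"
  shows "closed {s. near_isometry_on (U s ` V) (T s) \<epsilon>}"
proof -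
  have "{s. near_isometry_on (U s ` V) (T s) \<epsilon>} =
    (\<Inter>x\<in>V. {s. \<bar>(norm (T s (U s x)))\<^sup>2 - (norm (U s x))\<^sup>2\<bar> \<le> \<epsilon> * (norm (U s x))\<^sup>2})"
    by (auto simp: near_isometry_on_def)
  also have "closed \<dots>"
    by (intro closed_INT ballI closed_Collect_le continuous_intros assms)
  finally show ?thesis .
qed

lemma sets_Collect_closed:
  assumes "closed {s. P s}" "S \<in> borel_measurable M"
  shows "{\<omega>\<in>space M. P (S \<omega>)} \<in> sets M"
proof -
  have "{\<omega>\<in>space M. P (S \<omega>)} = S -` {s. P s} \<inter> space M" by auto
  then show ?thesis using measurable_sets[OF assms(2) borel_closed[OF assms(1)]] by simp
qed

text \<open>
  The tail exponent \<open>t\<^sup>2/8\<close> at \<open>t = 7/32 \<epsilon>\<close> equals \<open>49/8192 \<epsilon>\<^sup>2\<close>, and \<open>168 \<cdot> 49 > 8192\<close>;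
  the factor \<open>e\<^bsup>-6.9 n\<^esup>\<close> outweighs the size of the net, and \<open>6/\<delta>\<close> accounts for the two tails and
  for the failure probability \<open>\<delta>/3\<close>.
\<close>
lemma card_net_tail_bound:
  fixes \<epsilon> \<delta> k :: real
  assumes "0 < \<epsilon>" "0 < \<delta>" "D \<le> n"
    and k: "k \<ge> 168 * (1 / \<epsilon>\<^sup>2) * (6.9 * real n + ln (6 / \<delta>))"
    and pos: "0 \<le> 6.9 * real n + ln (6 / \<delta>)"
  shows "88 ^ D * (2 * exp (- k * (7 / 32 * \<epsilon>)\<^sup>2 / 8)) \<le> \<delta> / 3"
proof -
  define Q where "Q = 6.9 * real n + ln (6 / \<delta>)"
  have "168 * (1 / \<epsilon>\<^sup>2) * Q * ((7 / 32 * \<epsilon>)\<^sup>2 / 8) \<le> k * ((7 / 32 * \<epsilon>)\<^sup>2 / 8)"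
    using k unfolding Q_def by (rule mult_right_mono) simp
  moreover have "168 * (1 / \<epsilon>\<^sup>2) * Q * ((7 / 32 * \<epsilon>)\<^sup>2 / 8) = (168 * 49 / 8192) * Q"
    using assms(1) by (simp add: power2_eq_square)
  moreover have "1 * Q \<le> (168 * 49 / 8192) * Q"
    using pos unfolding Q_def by (intro mult_right_mono) auto
  ultimately have "- k * (7 / 32 * \<epsilon>)\<^sup>2 / 8 \<le> - Q" by simp
  then have "exp (- k * (7 / 32 * \<epsilon>)\<^sup>2 / 8) \<le> exp (- Q)" by (simp only: exp_le_cancel_iff)
  also have "exp (- Q) = exp (- (6.9 * real n)) * exp (- ln (6 / \<delta>))"
    by (simp only: Q_def minus_add_distrib exp_add)
  also have "exp (- ln (6 / \<delta>)) = \<delta> / 6" using assms(2) by (simp add: exp_minus)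
  finally have tail: "exp (- k * (7 / 32 * \<epsilon>)\<^sup>2 / 8) \<le> exp (- (6.9 * real n)) * (\<delta> / 6)" .
  have "(88::real) \<le> exp 6.9"
  proof -
    \<comment> \<open>The exponent is 6 times 23/20, and exp x is at least 1 + x.\<close>
    have "(88::real) \<le> (1 + 23 / 20) ^ 6" by (simp add: power_divide)
    also have "\<dots> \<le> exp (23 / 20) ^ 6" by (intro power_mono exp_ge_add_one_self) auto
    finally show ?thesis by (simp flip: exp_of_nat_mult)
  qed
  then have "(88::real) ^ n \<le> exp 6.9 ^ n" by (intro power_mono) auto
  also have "\<dots> = exp (6.9 * real n)" by (simp add: mult.commute flip: exp_of_nat_mult)
  finally have "(88::real) ^ D \<le> exp (6.9 * real n)"
    using power_increasing[OF assms(3), of "88::real"] by linarith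
  then have "88 ^ D * (2 * exp (- k * (7 / 32 * \<epsilon>)\<^sup>2 / 8)) \<le> exp (6.9 * real n) * (2 * (exp (- (6.9 * real n)) * (\<delta> / 6)))"
    using tail by (intro mult_mono) auto
  also have "\<dots> = \<delta> / 3" by (simp flip: exp_add)
  finally show ?thesis .
qed

text \<open>
  Net points need not have norm one, but scaling one of norm at most one up to the unit sphere only
  increases its defect.
\<close>
lemma (in prob_space) gaussian_near_isometry:
  fixes S :: "'a \<Rightarrow> real^'p^'k" and V :: "('b::scalar_field^'p^'q) set"
  assumes S: "rescaled_gaussian M S" "S \<in> borel_measurable M"
    and V: "subspace V" "dim V \<le> n" and \<epsilon>: "0 < \<epsilon>" "\<epsilon> < 1" and \<delta>: "0 < \<delta>" "\<delta> < 1"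
    and k: "real CARD('k) \<ge> 168 * (1 / \<epsilon>\<^sup>2) * (6.9 * real n + ln (6 / \<delta>))"
  shows "prob {\<omega>\<in>space M. near_isometry_on V (\<lambda>X. X ** adjoint_matrix (map_matrix of_real (S \<omega>))) (\<epsilon> / 4)}
      \<ge> 1 - \<delta> / 3"
proof -
  define T where "T s X = X ** adjoint_matrix (map_matrix of_real s)" for s :: "real^'p^'k" and X :: "'b^'p^'q"
  define t where "t = 7 / 32 * \<epsilon>"
  have t: "0 < t" "t \<le> 1" using \<epsilon> by (simp_all add: t_def)
  have linT: "linear (T s)" for s
    unfolding T_def adjoint_of_real_matrix
    by (rule linearI) (simp_all add: matrix_matrix_mult_def vec_eq_iff sum.distrib algebra_simps scaleR_sum_right)
  have contT: "continuous_on UNIV (\<lambda>s. T s X)" for X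
    unfolding T_def adjoint_of_real_matrix matrix_matrix_mult_def
    by (simp, intro continuous_intros)
  have normT: "(norm (T s X))\<^sup>2 = (\<Sum>i\<in>UNIV. (norm (\<Sum>j\<in>UNIV. s $ i $ j *\<^sub>R column j X))\<^sup>2)" for s X
    unfolding T_def by (subst norm_squared_columns) (simp add: column_mult_adjoint_real)
  obtain N where N: "finite N" "N \<subseteq> V \<inter> cball 0 1" "real (card N) \<le> 88 ^ dim V"
    "\<And>x. x \<in> V \<Longrightarrow> norm x \<le> 1 \<Longrightarrow> \<exists>p\<in>N. norm (x - p) \<le> 1 / 16"
    using unit_ball_net[OF V(1)] by metis
  define bad where "bad X = {\<omega>\<in>space M. \<bar>(norm (T (S \<omega>) X))\<^sup>2 - (norm X)\<^sup>2\<bar> \<ge> t}" for X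
  have meas [measurable]: "(\<lambda>\<omega>. T (S \<omega>) X) \<in> borel_measurable M" for X
    using borel_measurable_continuous_onI[OF contT] S(2) by (rule measurable_compose[rotated])
  have bad_sets: "bad X \<in> events" for X unfolding bad_def by measurable
  have bad_prob: "prob (bad X) \<le> 2 * exp (- real CARD('k) * t\<^sup>2 / 8)" if X: "X \<in> N" for X
  proof (cases "X = 0")
    case True
    then have "bad X = {}" using t linear_0[OF linT] by (auto simp: bad_def)
    then show ?thesis by simp
  next
    case False
    define U where "U = X /\<^sub>R norm X"
    have X1: "norm X \<le> 1" using X N(2) by auto
    have U: "norm U = 1" using False by (simp add: U_def)
    have "bad X \<subseteq> {\<omega>\<in>space M. \<bar>(\<Sum>i\<in>UNIV. (norm (\<Sum>j\<in>UNIV. S \<omega> $ i $ j *\<^sub>R column j U))\<^sup>2) - 1\<bar> \<ge> t}"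
    proof
      fix \<omega> assume "\<omega> \<in> bad X"
      then have \<omega>: "\<omega> \<in> space M" "t \<le> \<bar>(norm (T (S \<omega>) X))\<^sup>2 - (norm X)\<^sup>2\<bar>" by (auto simp: bad_def)
      have "(norm (T (S \<omega>) X))\<^sup>2 - (norm X)\<^sup>2 = (norm X)\<^sup>2 * ((norm (T (S \<omega>) U))\<^sup>2 - 1)"
        using False by (simp add: U_def linear_scale[OF linT] power_mult_distrib field_simps)
      then have "t \<le> (norm X)\<^sup>2 * \<bar>(norm (T (S \<omega>) U))\<^sup>2 - 1\<bar>" using \<omega>(2) by (simp add: abs_mult)
      also have "\<dots> \<le> 1 * \<bar>(norm (T (S \<omega>) U))\<^sup>2 - 1\<bar>"
        using X1 by (intro mult_right_mono) (auto simp: power_le_one)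
      finally show "\<omega> \<in> {\<omega>\<in>space M. \<bar>(\<Sum>i\<in>UNIV. (norm (\<Sum>j\<in>UNIV. S \<omega> $ i $ j *\<^sub>R column j U))\<^sup>2) - 1\<bar> \<ge> t}"
        using \<omega>(1) by (simp add: normT)
    qed
    moreover have "{\<omega>\<in>space M. \<bar>(\<Sum>i\<in>UNIV. (norm (\<Sum>j\<in>UNIV. S \<omega> $ i $ j *\<^sub>R column j U))\<^sup>2) - 1\<bar> \<ge> t} \<in> events"
      unfolding normT[symmetric] by measurable
    ultimately have "prob (bad X) \<le> prob {\<omega>\<in>space M. \<bar>(\<Sum>i\<in>UNIV. (norm (\<Sum>j\<in>UNIV. S \<omega> $ i $ j *\<^sub>R column j U))\<^sup>2) - 1\<bar> \<ge> t}"
      by (rule finite_measure_mono)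
    also have "\<dots> \<le> 2 * exp (- real CARD('k) * t\<^sup>2 / 8)"
      using U by (intro gaussian_matrix_concentration S t) (simp flip: norm_squared_columns)
    finally show ?thesis .
  qed
  define good where "good = {\<omega>\<in>space M. near_isometry_on V (T (S \<omega>)) (\<epsilon> / 4)}"
  have "closed {s. near_isometry_on V (T s) (\<epsilon> / 4)}"
    using closed_near_isometry_on_image[of V "\<lambda>s x. x" T "\<epsilon> / 4"] contT by simp
  then have good_sets: "good \<in> events"
    unfolding good_def using S(2) by (rule sets_Collect_closed)
  have "space M - good \<subseteq> (\<Union>X\<in>N. bad X)"
  proof
    fix \<omega> assume \<omega>: "\<omega> \<in> space M - good"
    show "\<omega> \<in> (\<Union>X\<in>N. bad X)"
    proof (rule ccontr)
      assume "\<omega> \<notin> (\<Union>X\<in>N. bad X)"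
      then have "\<bar>(norm (T (S \<omega>) p))\<^sup>2 - (norm p)\<^sup>2\<bar> \<le> t" if "p \<in> N" for p
        using \<omega> that by (auto simp: bad_def not_le intro: less_imp_le)
      then have "near_isometry_on V (T (S \<omega>)) (8 / 7 * t)"
        using near_isometry_on_from_net[OF linT V(1) N(2,4)] by blast
      then show False using \<omega> by (simp add: good_def t_def)
    qed
  qed
  then have "prob (space M - good) \<le> prob (\<Union>X\<in>N. bad X)"
    using N(1) bad_sets by (intro finite_measure_mono) auto
  also have "\<dots> \<le> (\<Sum>X\<in>N. prob (bad X))"
    using N(1) bad_sets by (intro measure_UNION_le) auto
  also have "\<dots> \<le> real (card N) * (2 * exp (- real CARD('k) * t\<^sup>2 / 8))"
    by (rule sum_bounded_above[OF bad_prob])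
  also have "\<dots> \<le> 88 ^ dim V * (2 * exp (- real CARD('k) * t\<^sup>2 / 8))"
    using N(3) by (intro mult_right_mono) auto
  also have "\<dots> \<le> \<delta> / 3"
    unfolding t_def using \<delta> by (intro card_net_tail_bound[where n = n] \<epsilon> \<delta> V(2) k add_nonneg_nonneg) auto
  finally show ?thesis
    using prob_compl[OF good_sets] unfolding good_def T_def[abs_def] by linarith
qed

section \<open>Conditioning on an independent variable\<close>

lemma (in prob_space) distr_pair_if_indep:
  fixes X :: "'a \<Rightarrow> 'x::topological_space" and Y :: "'a \<Rightarrow> 'y::topological_space"
  assumes X [measurable]: "X \<in> borel_measurable M" and Y [measurable]: "Y \<in> borel_measurable M"
    and ind: "\<And>A B. A \<in> sets borel \<Longrightarrow> B \<in> sets borel \<Longrightarrow>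
      prob ((X -` A \<inter> space M) \<inter> (Y -` B \<inter> space M)) = prob (X -` A \<inter> space M) * prob (Y -` B \<inter> space M)"
  shows "distr M borel X \<Otimes>\<^sub>M distr M borel Y = distr M (borel \<Otimes>\<^sub>M borel) (\<lambda>\<omega>. (X \<omega>, Y \<omega>))"
proof (rule pair_measure_eqI)
  interpret DX: prob_space "distr M borel X" by (rule prob_space_distr[OF X])
  interpret DY: prob_space "distr M borel Y" by (rule prob_space_distr[OF Y])
  show "sigma_finite_measure (distr M borel X)" "sigma_finite_measure (distr M borel Y)" by unfold_locales
  show "sets (distr M borel X \<Otimes>\<^sub>M distr M borel Y) = sets (distr M (borel \<Otimes>\<^sub>M borel) (\<lambda>\<omega>. (X \<omega>, Y \<omega>)))"
    by (simp cong: sets_pair_measure_cong)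
  fix A B assume "A \<in> sets (distr M borel X)" "B \<in> sets (distr M borel Y)"
  then have AB: "A \<in> sets borel" "B \<in> sets borel" by auto
  have "(\<lambda>\<omega>. (X \<omega>, Y \<omega>)) -` (A \<times> B) \<inter> space M = (X -` A \<inter> space M) \<inter> (Y -` B \<inter> space M)" by auto
  then show "emeasure (distr M borel X) A * emeasure (distr M borel Y) B
      = emeasure (distr M (borel \<Otimes>\<^sub>M borel) (\<lambda>\<omega>. (X \<omega>, Y \<omega>))) (A \<times> B)"
    using AB ind[OF AB] by (simp add: emeasure_distr emeasure_eq_measure ennreal_mult')
qed

text \<open>
  By independence the joint law is the product measure, and the measure of a set is the average of
  the measures of its sections.
\<close>
lemma (in prob_space) prob_ge_if_sections_ge:
  fixes X :: "'a \<Rightarrow> 'x::topological_space" and Y :: "'a \<Rightarrow> 'y::topological_space"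
  assumes X [measurable]: "X \<in> borel_measurable M" and Y [measurable]: "Y \<in> borel_measurable M"
    and ind: "\<And>A B. A \<in> sets borel \<Longrightarrow> B \<in> sets borel \<Longrightarrow>
      prob ((X -` A \<inter> space M) \<inter> (Y -` B \<inter> space M)) = prob (X -` A \<inter> space M) * prob (Y -` B \<inter> space M)"
    and C [measurable]: "C \<in> sets (borel \<Otimes>\<^sub>M borel)"
    and sect: "\<And>x. prob {\<omega>\<in>space M. (x, Y \<omega>) \<in> C} \<ge> p"
  shows "prob {\<omega>\<in>space M. (X \<omega>, Y \<omega>) \<in> C} \<ge> p"
proof -
  interpret DX: prob_space "distr M borel X" by (rule prob_space_distr[OF X])
  interpret DY: prob_space "distr M borel Y" by (rule prob_space_distr[OF Y])
  have C': "C \<in> sets (distr M borel X \<Otimes>\<^sub>M distr M borel Y)"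
    using C by (simp cong: sets_pair_measure_cong)
  have sections: "ennreal p \<le> emeasure (distr M borel Y) (Pair x -` C)" for x
  proof -
    have "Pair x -` C \<in> sets borel" using sets_Pair1[OF C] .
    then have "emeasure (distr M borel Y) (Pair x -` C) = emeasure M (Y -` (Pair x -` C) \<inter> space M)"
      by (simp add: emeasure_distr)
    also have "Y -` (Pair x -` C) \<inter> space M = {\<omega>\<in>space M. (x, Y \<omega>) \<in> C}" by auto
    finally show ?thesis using sect[of x] by (simp add: emeasure_eq_measure ennreal_leI)
  qed
  have "ennreal p = (\<integral>\<^sup>+x. ennreal p \<partial>distr M borel X)"
    by (simp add: DX.emeasure_space_1[simplified])
  also have "\<dots> \<le> (\<integral>\<^sup>+x. emeasure (distr M borel Y) (Pair x -` C) \<partial>distr M borel X)"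
    by (intro nn_integral_mono sections)
  also have "\<dots> = emeasure (distr M borel X \<Otimes>\<^sub>M distr M borel Y) C"
    by (rule DY.emeasure_pair_measure_alt[OF C', symmetric])
  also have "\<dots> = emeasure M ((\<lambda>\<omega>. (X \<omega>, Y \<omega>)) -` C \<inter> space M)"
    by (subst distr_pair_if_indep[OF X Y]) (simp_all add: ind emeasure_distr)
  also have "(\<lambda>\<omega>. (X \<omega>, Y \<omega>)) -` C \<inter> space M = {\<omega>\<in>space M. (X \<omega>, Y \<omega>) \<in> C}" by auto
  finally show ?thesis by (simp add: emeasure_eq_measure)
qed

lemma (in prob_space) indep_var3_first_second:
  assumes ind: "indep_var3 M X Y Z" and AB: "A \<in> sets borel" "B \<in> sets borel"
  shows "prob ((X -` A \<inter> space M) \<inter> (Y -` B \<inter> space M)) = prob (X -` A \<inter> space M) * prob (Y -` B \<inter> space M)"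
proof -
  define E where "E i = [sets (vimage_algebra (space M) X borel), sets (vimage_algebra (space M) Y borel),
             sets (vimage_algebra (space M) Z borel)] ! i" for i
  have E: "indep_sets E {..<3}" using ind by (simp add: indep_var3_def E_def[abs_def])
  define F where "F i = (if i = (0::nat) then X -` A \<inter> space M else Y -` B \<inter> space M)" for i
  have "prob (\<Inter>i\<in>{0,1}. F i) = (\<Prod>i\<in>{0,1}. prob (F i))"
    by (rule indep_setsD[OF E]) (auto simp: F_def E_def in_vimage_algebra AB)
  then show ?thesis by (simp add: F_def Int_commute)
qed

text \<open>
  The set \<open>A\<close> need not be a rectangle, so the factorization in the definition of independence does not
  apply directly: the \<open>\<sigma>\<close>-algebra generated by the first two variables together is independent of
  that of the third.
\<close>
lemma (in prob_space) indep_var3_pair_third: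
  fixes X :: "'a \<Rightarrow> 'x::second_countable_topology" and Y :: "'a \<Rightarrow> 'y::second_countable_topology"
  assumes ind: "indep_var3 M X Y Z" and AB: "A \<in> sets borel" "B \<in> sets borel"
  shows "prob (((\<lambda>\<omega>. (X \<omega>, Y \<omega>)) -` A \<inter> space M) \<inter> (Z -` B \<inter> space M))
    = prob ((\<lambda>\<omega>. (X \<omega>, Y \<omega>)) -` A \<inter> space M) * prob (Z -` B \<inter> space M)"
proof -
  define E where "E i = [sets (vimage_algebra (space M) X borel), sets (vimage_algebra (space M) Y borel),
             sets (vimage_algebra (space M) Z borel)] ! i" for i
  have E: "indep_sets E {..<3}" using ind by (simp add: indep_var3_def E_def[abs_def])
  define I where "I j = (if j = (0::nat) then {0, 1::nat} else {2})" for j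
  have stable: "Int_stable (E i)" if "i < 3" for i
    using that by (auto simp: E_def less_Suc_eq numeral_3_eq_3 intro: sets.Int_stable)
  have "(\<Union>j\<in>{0,1}. I j) = {..<3}" by (auto simp: I_def)
  then have ind2: "indep_sets (\<lambda>j. sigma_sets (space M) (\<Union>i\<in>I j. E i)) {0, 1}"
    using E stable by (intro indep_sets_collect_sigma) (auto simp: I_def disjoint_family_on_def split: if_splits)
  define N where "N = sigma (space M) (E 0 \<union> E 1)"
  have sub: "E 0 \<union> E 1 \<subseteq> Pow (space M)"
    using sets.sets_into_space by (fastforce simp: E_def)
  have N: "space N = space M" "sets N = sigma_sets (space M) (E 0 \<union> E 1)"
    using sub by (simp_all add: N_def)
  have [measurable]: "X \<in> borel_measurable N"
    by (rule measurableI) (auto simp: N E_def intro!: sigma_sets.Basic in_vimage_algebra)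
  have [measurable]: "Y \<in> borel_measurable N"
    by (rule measurableI) (auto simp: N E_def intro!: sigma_sets.Basic in_vimage_algebra)
  have "(\<lambda>\<omega>. (X \<omega>, Y \<omega>)) \<in> borel_measurable N" by measurable
  then have "(\<lambda>\<omega>. (X \<omega>, Y \<omega>)) -` A \<inter> space N \<in> sets N" using AB by (intro measurable_sets)
  then have first: "(\<lambda>\<omega>. (X \<omega>, Y \<omega>)) -` A \<inter> space M \<in> sigma_sets (space M) (E 0 \<union> E 1)" by (simp add: N)
  define F where "F i = (if i = (0::nat) then (\<lambda>\<omega>. (X \<omega>, Y \<omega>)) -` A \<inter> space M else Z -` B \<inter> space M)" for i
  have "prob (\<Inter>i\<in>{0,1}. F i) = (\<Prod>i\<in>{0,1}. prob (F i))"
    using first by (intro indep_setsD[OF ind2])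
      (auto simp: F_def I_def E_def AB intro!: sigma_sets.Basic in_vimage_algebra)
  then show ?thesis by (simp add: F_def Int_commute)
qed

text \<open>
  The space that \<open>Y\<close> must embed is a random one, but it depends on \<open>Z\<close> only. For each value of \<open>Z\<close> it is
  contained in a fixed subspace of dimension \<open>d\<close>, which \<open>Y\<close> embeds with probability \<open>1 - \<delta>\<close>.
\<close>
lemma (in prob_space) prob_near_isometry_on_random_image:
  fixes Z :: "'a \<Rightarrow> 's::second_countable_topology" and Y :: "'a \<Rightarrow> 'b::scalar_field^'n^'m"
    and L :: "'s \<Rightarrow> 'z::ab_group_add \<Rightarrow> 'b^'n"
  assumes Z: "Z \<in> borel_measurable M" and Y: "Y \<in> borel_measurable M"
    and ind: "\<And>A B. A \<in> sets borel \<Longrightarrow> B \<in> sets borel \<Longrightarrow>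
      prob ((Z -` A \<inter> space M) \<inter> (Y -` B \<inter> space M)) = prob (Z -` A \<inter> space M) * prob (Y -` B \<inter> space M)"
    and emb: "oblivious_subspace_embedding M (*s) canonical_inner \<epsilon> \<delta> d (\<lambda>\<omega> x. Y \<omega> *v x)"
    and L: "\<And>s. Vector_Spaces.linear smul (*s) (L s)" "\<And>x. continuous_on UNIV (\<lambda>s. L s x)"
    and V: "vector_space.dim smul V = d"
  shows "prob {\<omega>\<in>space M. near_isometry_on (L (Z \<omega>) ` V) ((*v) (Y \<omega>)) \<epsilon>} \<ge> 1 - \<delta>"
proof -
  interpret C: compatible_inner_product "(*s)" "canonical_inner :: 'b^'n \<Rightarrow> _"
    by (rule canonical_inner_product)
  have d: "1 \<le> d" "d \<le> CARD('n)"
    using emb vec_dim_card[where 'a='b and 'n='n] by (auto simp: oblivious_subspace_embedding_def)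
  define C where "C = {zy. near_isometry_on (L (fst zy) ` V) ((*v) (snd zy :: 'b^'n^'m)) \<epsilon>}"
  have "continuous_on UNIV (\<lambda>zy :: 's \<times> ('b^'n^'m). L (fst zy) x)" for x
    using continuous_on_compose2[OF L(2)] continuous_on_fst[OF continuous_on_id] by auto
  moreover from this have "continuous_on UNIV (\<lambda>zy :: 's \<times> ('b^'n^'m). snd zy *v L (fst zy) x)" for x
    unfolding matrix_vector_mult_def by (intro continuous_intros)
  ultimately have "closed C"
    unfolding C_def by (intro closed_near_isometry_on_image)
  then have C: "C \<in> sets (borel \<Otimes>\<^sub>M borel)" unfolding borel_prod by (rule borel_closed)
  have "prob {\<omega>\<in>space M. (z, Y \<omega>) \<in> C} \<ge> 1 - \<delta>" for z
  proof -
    obtain W where W: "vec.subspace W" "vec.dim W = d" "L z ` V \<subseteq> W"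
      using vec_subspace_extend[OF vec_dim_linear_image_le[OF L(1) V d(1)] d(2)] by metis
    have "1 - \<delta> \<le> prob {\<omega>\<in>space M. \<forall>x\<in>W. \<forall>y\<in>W. norm (canonical_inner x y - canonical_inner (Y \<omega> *v x) (Y \<omega> *v y))
              \<le> \<epsilon> * induced_norm canonical_inner x * induced_norm canonical_inner y}"
      using emb W by (simp add: oblivious_subspace_embedding_def)
    also have "\<dots> = prob {\<omega>\<in>space M. near_isometry_on W ((*v) (Y \<omega>)) \<epsilon>}"
      unfolding C.embedding_iff_near_isometry[OF matrix_vector_mul_linear_gen W(1)] ..
    also have "\<dots> \<le> prob {\<omega>\<in>space M. (z, Y \<omega>) \<in> C}"
    proof (rule finite_measure_mono)
      show "{\<omega>\<in>space M. near_isometry_on W ((*v) (Y \<omega>)) \<epsilon>} \<subseteq> {\<omega>\<in>space M. (z, Y \<omega>) \<in> C}"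
        using W(3) by (auto simp: C_def near_isometry_on_def)
      have "Y -` (Pair z -` C) \<inter> space M \<in> events"
        using Y sets_Pair1[OF C] by (rule measurable_sets)
      also have "Y -` (Pair z -` C) \<inter> space M = {\<omega>\<in>space M. (z, Y \<omega>) \<in> C}" by auto
      finally show "{\<omega>\<in>space M. (z, Y \<omega>) \<in> C} \<in> events" .
    qed
    finally show ?thesis .
  qed
  then have "prob {\<omega>\<in>space M. (Z \<omega>, Y \<omega>) \<in> C} \<ge> 1 - \<delta>"
    using prob_ge_if_sections_ge[OF Z Y _ C] ind by blast
  then show ?thesis by (simp add: C_def)
qed

section \<open>Composition of the three stages\<close>

text \<open>
  The total distortion is at most \<open>h(1 + (1 + h) + (1 + h)\<^sup>2)\<close>, and the second factor is below four
  for \<open>h \<le> 1/4\<close>.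
\<close>
lemma three_step_distortion:
  fixes a b c e h :: real
  assumes "0 \<le> a" "0 \<le> h" "h \<le> 1 / 4"
    and "\<bar>b - a\<bar> \<le> h * a" "\<bar>c - b\<bar> \<le> h * b" "\<bar>e - c\<bar> \<le> h * c"
  shows "\<bar>e - a\<bar> \<le> 4 * h * a"
proof -
  have "h * a \<le> 1 / 4 * a" using assms by (intro mult_right_mono) auto
  then have b: "b \<le> 5 / 4 * a" "0 \<le> b" using assms by linarith+
  have "h * b \<le> 1 / 4 * b" using assms b by (intro mult_right_mono) auto
  then have c: "c \<le> 25 / 16 * a" using assms b by linarith
  have "h * (a + b + c) \<le> h * (4 * a)" using assms b c by (intro mult_left_mono) auto
  then show ?thesis using assms by (simp add: algebra_simps)
qed

lemma column_linear:
  "column i (A + B) = column i A + column i B"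
  "column i (scale_matrix c A) = c *s column i A"
  by (simp_all add: column_def scale_matrix_def map_matrix_def vec_eq_iff)

lemma matrix_mult_scale_matrix:
  "A ** scale_matrix c B = scale_matrix (c :: 'a::comm_semiring_1) (A ** B)"
  by (simp add: scale_matrix_def map_matrix_def matrix_matrix_mult_def vec_eq_iff sum_distrib_left mult_ac)

text \<open>
  The failure events of the three stages have probabilities at most \<open>\<delta>/3\<close> each; for the second
  stage this is a union bound over the \<open>k\<^sub>\<Sigma>\<close> columns of \<open>X\<Sigma>\<^sup>*\<close>.
\<close>
lemma Upsilon_oblivious_subspace_embedding:
  fixes \<Sigma> :: "'w \<Rightarrow> real^'p^'ks" and \<Omega> :: "'w \<Rightarrow> 'b::scalar_field^'q^'ko"
    and \<Gamma> :: "'w \<Rightarrow> 'b^('ks \<times> 'ko)^'k"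
  assumes M: "prob_space M" and \<epsilon>: "0 < \<epsilon>" "\<epsilon> < 1" and \<delta>: "0 < \<delta>" "\<delta> < 1"
    and gauss: "rescaled_gaussian M \<Sigma>" and ind: "indep_var3 M \<Sigma> \<Omega> \<Gamma>"
    and emb_\<Omega>: "oblivious_subspace_embedding M (*s) canonical_inner
          (\<epsilon> / 4) (\<delta> / (3 * real CARD('ks))) d (\<lambda>\<omega> x. \<Omega> \<omega> *v x)"
    and emb_\<Gamma>: "oblivious_subspace_embedding M (*s) canonical_inner
          (\<epsilon> / 4) (\<delta> / 3) d (\<lambda>\<omega> x. \<Gamma> \<omega> *v x)"
    and ks: "real CARD('ks) \<ge> 168 * (1 / \<epsilon>^2) * (6.9 * real DIM('b) * real d + ln (6 / \<delta>))"
  shows "oblivious_subspace_embedding M scale_matrix frobenius_inner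
          \<epsilon> \<delta> d (\<lambda>\<omega> (X :: 'b^'p^'q). Upsilon (\<Sigma> \<omega>) (\<Omega> \<omega>) (\<Gamma> \<omega>) X)"
proof -
  interpret prob_space M by fact
  interpret F: compatible_inner_product scale_matrix "frobenius_inner :: 'b^'p^'q \<Rightarrow> _"
    by (rule frobenius_inner_product)
  have d: "1 \<le> d" "d \<le> CARD('q)"
    using emb_\<Omega> vec_dim_card[where 'a='b and 'n='q] by (auto simp: oblivious_subspace_embedding_def)
  have meas: "\<Sigma> \<in> borel_measurable M" "\<Omega> \<in> borel_measurable M" "\<Gamma> \<in> borel_measurable M"
    using ind by (auto simp: indep_var3_def)
  have meas2: "(\<lambda>\<omega>. (\<Sigma> \<omega>, \<Omega> \<omega>)) \<in> borel_measurable M"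
    by (intro borel_measurable_Pair meas)
  have meas3: "(\<lambda>\<omega>. ((\<Sigma> \<omega>, \<Omega> \<omega>), \<Gamma> \<omega>)) \<in> borel_measurable M"
    by (intro borel_measurable_Pair meas2 meas)
  \<comment> \<open>\<open>L2 i\<close> produces the vectors that \<open>\<Omega>\<close> has to embed, and \<open>L3\<close> those that \<open>\<Gamma>\<close> has to embed.\<close>
  define R where "R s X = X ** adjoint_matrix (map_matrix of_real s)" for s :: "real^'p^'ks" and X :: "'b^'p^'q"
  define L2 where "L2 i s X = column i (R s X)" for i s X
  define L3 where "L3 so X = vectorize (snd so ** R (fst so) X)" for so :: "(real^'p^'ks) \<times> ('b^'q^'ko)" and X
  have U: "Upsilon s o' g X = g *v L3 (s, o') X" for s o' X and g :: "'b^('ks \<times> 'ko)^'k"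
    by (simp add: Upsilon_def L3_def R_def matrix_mul_assoc)
  have R_lin: "R s (X + Y) = R s X + R s Y" "R s (scale_matrix c X) = scale_matrix c (R s X)" for s X Y c
  proof -
    interpret R: Vector_Spaces.linear scale_matrix scale_matrix "R s"
      unfolding R_def[abs_def] by (rule linear_mult_adjoint_real)
    show "R s (X + Y) = R s X + R s Y" "R s (scale_matrix c X) = scale_matrix c (R s X)"
      by (rule R.add, rule R.scale)
  qed
  have lin2: "Vector_Spaces.linear scale_matrix (*s) (L2 i s)" for i s
    by unfold_locales (simp_all add: L2_def R_lin column_linear)
  have lin3: "Vector_Spaces.linear scale_matrix (*s) (L3 so)" for so
    by unfold_locales (simp_all add: L3_def R_lin vectorize_linear matrix_add_ldistrib matrix_mult_scale_matrix)
  have linU: "Vector_Spaces.linear scale_matrix (*s) (Upsilon s o' g :: 'b^'p^'q \<Rightarrow> 'b^'k)" for s o' and g :: "'b^('ks \<times> 'ko)^'k"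
  proof -
    interpret L3: Vector_Spaces.linear scale_matrix "(*s)" "L3 (s, o')" by (rule lin3)
    show ?thesis
      by unfold_locales (simp_all add: U L3.add L3.scale matrix_vector_right_distrib vec.scale)
  qed
  have cont2: "continuous_on UNIV (\<lambda>s. L2 i s X)" for i X
    unfolding L2_def R_def column_mult_adjoint_real by (intro continuous_intros)
  have cont3: "continuous_on UNIV (\<lambda>so. L3 so X)" for X
    unfolding L3_def R_def vectorize_def matrix_matrix_mult_def adjoint_of_real_matrix
    by (simp, intro continuous_intros)
  have contU: "continuous_on UNIV (\<lambda>sog :: ((real^'p^'ks) \<times> ('b^'q^'ko)) \<times> ('b^('ks \<times> 'ko)^'k).
      Upsilon (fst (fst sog)) (snd (fst sog)) (snd sog) X)" for X
  proof -
    have "continuous_on UNIV (\<lambda>sog :: ((real^'p^'ks) \<times> ('b^'q^'ko)) \<times> ('b^('ks \<times> 'ko)^'k). L3 (fst sog) X)"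
      using continuous_on_compose2[OF cont3] continuous_on_fst[OF continuous_on_id] by auto
    then show ?thesis unfolding U prod.collapse matrix_vector_mult_def by (intro continuous_intros)
  qed
  have random: "random_linear_map M scale_matrix (\<lambda>\<omega> (X :: 'b^'p^'q). Upsilon (\<Sigma> \<omega>) (\<Omega> \<omega>) (\<Gamma> \<omega>) X)"
    unfolding random_linear_map_def
    using linU measurable_compose[OF meas3 borel_measurable_continuous_onI[OF contU]] by simp
  have dim: "d \<le> F.dim UNIV"
    using d(2) order_trans[of d "1 * CARD('q)" "CARD('p) * CARD('q)"] by (simp add: dim_scale_matrix_UNIV)
  have "prob {\<omega> \<in> space M. near_isometry_on V (Upsilon (\<Sigma> \<omega>) (\<Omega> \<omega>) (\<Gamma> \<omega>)) \<epsilon>} \<ge> 1 - \<delta>"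
    if V: "F.subspace V" "F.dim V = d" for V :: "('b^'p^'q) set"
  proof -
    define A where "A = {\<omega>\<in>space M. near_isometry_on V (R (\<Sigma> \<omega>)) (\<epsilon> / 4)}"
    define B where "B i = {\<omega>\<in>space M. near_isometry_on (L2 i (\<Sigma> \<omega>) ` V) ((*v) (\<Omega> \<omega>)) (\<epsilon> / 4)}" for i
    define C where "C = {\<omega>\<in>space M. near_isometry_on (L3 (\<Sigma> \<omega>, \<Omega> \<omega>) ` V) ((*v) (\<Gamma> \<omega>)) (\<epsilon> / 4)}"
    define G where "G = {\<omega> \<in> space M. near_isometry_on V (Upsilon (\<Sigma> \<omega>) (\<Omega> \<omega>) (\<Gamma> \<omega>)) \<epsilon>}"
    have A: "prob A \<ge> 1 - \<delta> / 3"
      unfolding A_def R_def[abs_def]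
      using ks F.real_dim_le[OF V(2) d(1)]
      by (intro gaussian_near_isometry[where n = "DIM('b) * d"] gauss meas F.real_subspace V \<epsilon> \<delta>) simp_all
    have B: "prob (B i) \<ge> 1 - \<delta> / (3 * real CARD('ks))" for i
      unfolding B_def
      by (rule prob_near_isometry_on_random_image[OF meas(1,2) indep_var3_first_second[OF ind] emb_\<Omega> lin2 cont2 V(2)])
    have C: "prob C \<ge> 1 - \<delta> / 3"
      unfolding C_def
      by (rule prob_near_isometry_on_random_image[OF meas2 meas(3) indep_var3_pair_third[OF ind] emb_\<Gamma> lin3 cont3 V(2)])
    have contR: "continuous_on UNIV (\<lambda>s. R s X)" for X
      unfolding R_def matrix_matrix_mult_def adjoint_of_real_matrix by (simp, intro continuous_intros)
    have "closed {s. near_isometry_on V (R s) (\<epsilon> / 4)}"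
      using closed_near_isometry_on_image[of V "\<lambda>s x. x" R "\<epsilon> / 4"] contR by simp
    then have A_sets: "A \<in> events" unfolding A_def using meas(1) by (rule sets_Collect_closed)
    have "closed {so. near_isometry_on (L2 i (fst so) ` V) ((*v) (snd so :: 'b^'q^'ko)) (\<epsilon> / 4)}" for i
    proof (rule closed_near_isometry_on_image)
      show *: "continuous_on UNIV (\<lambda>so. L2 i (fst so) X)" for X
        by (rule continuous_on_compose2[OF cont2 continuous_on_fst[OF continuous_on_id]]) simp
      show "continuous_on UNIV (\<lambda>so. snd so *v L2 i (fst so) X)" for X
        unfolding matrix_vector_mult_def by (intro continuous_intros *)
    qed
    from sets_Collect_closed[OF this meas2] have B_sets: "B i \<in> events" for i by (simp add: B_def)
    have "closed {sog. near_isometry_on (L3 (fst sog) ` V) ((*v) (snd sog :: 'b^('ks \<times> 'ko)^'k)) (\<epsilon> / 4)}"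
    proof (rule closed_near_isometry_on_image)
      show *: "continuous_on UNIV (\<lambda>so. L3 (fst so) X)" for X
        using continuous_on_compose2[OF cont3] continuous_on_fst[OF continuous_on_id] by auto
      show "continuous_on UNIV (\<lambda>so. snd so *v L3 (fst so) X)" for X
        unfolding matrix_vector_mult_def by (intro continuous_intros *)
    qed
    from sets_Collect_closed[OF this meas3] have C_sets: "C \<in> events" by (simp add: C_def)
    have "closed {sog :: ((real^'p^'ks) \<times> ('b^'q^'ko)) \<times> ('b^('ks \<times> 'ko)^'k).
        near_isometry_on V (Upsilon (fst (fst sog)) (snd (fst sog)) (snd sog)) \<epsilon>}"
      using closed_near_isometry_on_image[of V "\<lambda>s x. x"
          "\<lambda>sog :: ((real^'p^'ks) \<times> ('b^'q^'ko)) \<times> ('b^('ks \<times> 'ko)^'k).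
            Upsilon (fst (fst sog)) (snd (fst sog)) (snd sog)" \<epsilon>] contU by simp
    from sets_Collect_closed[OF this meas3] have G_sets: "G \<in> events" by (simp add: G_def)
    have sub: "space M - G \<subseteq> (space M - A) \<union> (\<Union>i\<in>UNIV. space M - B i) \<union> (space M - C)"
    proof
      fix \<omega> assume \<omega>: "\<omega> \<in> space M - G"
      show "\<omega> \<in> (space M - A) \<union> (\<Union>i\<in>UNIV. space M - B i) \<union> (space M - C)"
      proof (rule ccontr)
        assume "\<omega> \<notin> (space M - A) \<union> (\<Union>i\<in>UNIV. space M - B i) \<union> (space M - C)"
        then have ABC: "\<omega> \<in> A" "\<And>i. \<omega> \<in> B i" "\<omega> \<in> C" using \<omega> by auto
        have "\<bar>(norm (Upsilon (\<Sigma> \<omega>) (\<Omega> \<omega>) (\<Gamma> \<omega>) X))\<^sup>2 - (norm X)\<^sup>2\<bar> \<le> 4 * (\<epsilon> / 4) * (norm X)\<^sup>2" if X: "X \<in> V" for X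
        proof (rule three_step_distortion)
          show "\<bar>(norm (R (\<Sigma> \<omega>) X))\<^sup>2 - (norm X)\<^sup>2\<bar> \<le> \<epsilon> / 4 * (norm X)\<^sup>2"
            using ABC(1) X by (simp add: A_def near_isometry_on_def)
          show "\<bar>(norm (Upsilon (\<Sigma> \<omega>) (\<Omega> \<omega>) (\<Gamma> \<omega>) X))\<^sup>2 - (norm (L3 (\<Sigma> \<omega>, \<Omega> \<omega>) X))\<^sup>2\<bar> \<le> \<epsilon> / 4 * (norm (L3 (\<Sigma> \<omega>, \<Omega> \<omega>) X))\<^sup>2"
            using ABC(3) X by (simp add: C_def near_isometry_on_def U)
          have col: "\<bar>(norm (\<Omega> \<omega> *v column i (R (\<Sigma> \<omega>) X)))\<^sup>2 - (norm (column i (R (\<Sigma> \<omega>) X)))\<^sup>2\<bar>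
              \<le> \<epsilon> / 4 * (norm (column i (R (\<Sigma> \<omega>) X)))\<^sup>2" for i
            using ABC(2)[of i] X by (simp add: B_def near_isometry_on_def L2_def)
          have L3: "(norm (L3 (\<Sigma> \<omega>, \<Omega> \<omega>) X))\<^sup>2 = (\<Sum>i\<in>UNIV. (norm (\<Omega> \<omega> *v column i (R (\<Sigma> \<omega>) X)))\<^sup>2)"
          proof -
            have "column i (\<Omega> \<omega> ** R (\<Sigma> \<omega>) X) = \<Omega> \<omega> *v column i (R (\<Sigma> \<omega>) X)" for i
              by (simp add: column_def matrix_matrix_mult_def matrix_vector_mult_def)
            then show ?thesis by (simp add: L3_def norm_vectorize norm_squared_columns)
          qed
          have "\<bar>(norm (L3 (\<Sigma> \<omega>, \<Omega> \<omega>) X))\<^sup>2 - (norm (R (\<Sigma> \<omega>) X))\<^sup>2\<bar>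
              \<le> (\<Sum>i\<in>UNIV. \<bar>(norm (\<Omega> \<omega> *v column i (R (\<Sigma> \<omega>) X)))\<^sup>2 - (norm (column i (R (\<Sigma> \<omega>) X)))\<^sup>2\<bar>)"
            unfolding L3 norm_squared_columns[of "R (\<Sigma> \<omega>) X"] sum_subtractf[symmetric] by (rule sum_abs)
          also have "\<dots> \<le> (\<Sum>i\<in>UNIV. \<epsilon> / 4 * (norm (column i (R (\<Sigma> \<omega>) X)))\<^sup>2)" by (intro sum_mono col)
          also have "\<dots> = \<epsilon> / 4 * (norm (R (\<Sigma> \<omega>) X))\<^sup>2"
            by (subst norm_squared_columns[of "R (\<Sigma> \<omega>) X"]) (simp only: sum_distrib_left)
          finally show "\<bar>(norm (L3 (\<Sigma> \<omega>, \<Omega> \<omega>) X))\<^sup>2 - (norm (R (\<Sigma> \<omega>) X))\<^sup>2\<bar> \<le> \<epsilon> / 4 * (norm (R (\<Sigma> \<omega>) X))\<^sup>2" .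
        qed (use \<epsilon> in auto)
        then have "\<omega> \<in> G" using \<omega> by (simp add: G_def near_isometry_on_def)
        then show False using \<omega> by simp
      qed
    qed
    have "prob (space M - G) \<le> prob ((space M - A) \<union> (\<Union>i\<in>UNIV. space M - B i) \<union> (space M - C))"
      using sub A_sets B_sets C_sets by (intro finite_measure_mono) auto
    also have "\<dots> \<le> prob (space M - A) + prob (\<Union>i\<in>UNIV. space M - B i) + prob (space M - C)"
      using A_sets B_sets C_sets by (intro order_trans[OF measure_Un_le] add_mono measure_Un_le order_refl) auto
    also have "prob (\<Union>i\<in>UNIV. space M - B i) \<le> (\<Sum>i\<in>UNIV. prob (space M - B i))"
      using B_sets by (intro measure_UNION_le) auto
    also have "(\<Sum>i\<in>UNIV. prob (space M - B i)) \<le> (\<Sum>i\<in>(UNIV::'ks set). \<delta> / (3 * real CARD('ks)))"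
      using B B_sets by (intro sum_mono) (simp add: prob_compl algebra_simps)
    also have "\<dots> = \<delta> / 3" by simp
    finally have "prob (space M - G) \<le> prob (space M - A) + \<delta> / 3 + prob (space M - C)" by simp
    then show ?thesis
      using A C prob_compl[OF A_sets] prob_compl[OF C_sets] prob_compl[OF G_sets] by (simp add: G_def)
  qed
  then show ?thesis
    unfolding oblivious_subspace_embedding_def
    using d(1) dim random F.embedding_iff_near_isometry[OF linU] by simp
qed

theorem proposition3p4:
  fixes M :: "'w measure"
    and \<Sigma> :: "'w \<Rightarrow> real^'p^'ks"
    and \<epsilon> \<delta> :: real
    and d :: nat
  assumes "prob_space M"
    and "0 < \<epsilon>" "\<epsilon> < 1" "0 < \<delta>" "\<delta> < 1"
    and "1 \<le> d"
    and "rescaled_gaussian M \<Sigma>"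
  shows "(\<forall>(\<Omega> :: 'w \<Rightarrow> real^'q^'ko) (\<Gamma> :: 'w \<Rightarrow> real^('ks \<times> 'ko)^'k).
        indep_var3 M \<Sigma> \<Omega> \<Gamma> \<longrightarrow>
        oblivious_subspace_embedding M (*s) canonical_inner
          (\<epsilon> / 4) (\<delta> / (3 * real CARD('ks))) d (\<lambda>\<omega> x. \<Omega> \<omega> *v x) \<longrightarrow>
        oblivious_subspace_embedding M (*s) canonical_inner
          (\<epsilon> / 4) (\<delta> / 3) d (\<lambda>\<omega> x. \<Gamma> \<omega> *v x) \<longrightarrow>
        real CARD('ks) \<ge> 168 * (1 / \<epsilon>^2) * (6.9 * 1 * real d + ln (6 / \<delta>)) \<longrightarrow>
        oblivious_subspace_embedding M scale_matrix frobenius_inner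
          \<epsilon> \<delta> d (\<lambda>\<omega> (X :: real^'p^'q). Upsilon (\<Sigma> \<omega>) (\<Omega> \<omega>) (\<Gamma> \<omega>) X))
    \<and>
     (\<forall>(\<Omega> :: 'w \<Rightarrow> complex^'q^'ko) (\<Gamma> :: 'w \<Rightarrow> complex^('ks \<times> 'ko)^'k).
        indep_var3 M \<Sigma> \<Omega> \<Gamma> \<longrightarrow>
        oblivious_subspace_embedding M (*s) canonical_inner
          (\<epsilon> / 4) (\<delta> / (3 * real CARD('ks))) d (\<lambda>\<omega> x. \<Omega> \<omega> *v x) \<longrightarrow>
        oblivious_subspace_embedding M (*s) canonical_inner
          (\<epsilon> / 4) (\<delta> / 3) d (\<lambda>\<omega> x. \<Gamma> \<omega> *v x) \<longrightarrow>
        real CARD('ks) \<ge> 168 * (1 / \<epsilon>^2) * (6.9 * 2 * real d + ln (6 / \<delta>)) \<longrightarrow>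
        oblivious_subspace_embedding M scale_matrix frobenius_inner
          \<epsilon> \<delta> d (\<lambda>\<omega> (X :: complex^'p^'q). Upsilon (\<Sigma> \<omega>) (\<Omega> \<omega>) (\<Gamma> \<omega>) X))"
  using assms by (intro conjI allI impI Upsilon_oblivious_subspace_embedding) simp_all

end
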